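(* Let $\tau$ be a generic Euclidean triangle with triangle group $G_\tau=\langle r_1,r_2,r_3\rangle$ and rotation subgroup $H_\tau$ (see context). Then $H_\tau$ is a free metabelian group of rank 2 generated by the rotations $r_1r_2$ and $r_1r_3$; that is, $H_\tau$ is isomorphic to $F_2/[[F_2,F_2],[F_2,F_2]]$, where $F_2$ is the free group on two generators, with $r_1r_2$ and $r_1r_3$ corresponding to the images of a free basis of $F_2$. As a consequence, $G_\tau$ does not admit any finite presentation.
   Context: A Euclidean triangle $\tau=A_1A_2A_3$ has edges $e_i=A_jA_k$ of length $\ell_i>0$, $\{i,j,k\}=\{1,2,3\}$. It is generic if for some real $k>0$ the numbers $k\ell_1,k\ell_2,k\ell_3$ are algebraically independent over $\mathbb{Q}$. Let $r_i$ be the reflection of the plane across the line containing $e_i$ and $G_\tau=\langle r_1,r_2,r_3\rangle\subset \mathrm{E}(2)$, with products composed left to right ($(x)gh=((x)g)h$). The rotation subgroup is $H_\tau=G_\tau\cap \mathrm{SE}(2)$, the index-2 subgroup of orientation-preserving elements of $G_\tau$. *)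

theory Defs
  imports "HOL-Analysis.Analysis" "HOL-Algebra.Algebra"
begin

text \<open>A letter is a generator together with a sign (True = positive, False = inverse).\<close>

definition red_cons :: "'a \<times> bool \<Rightarrow> ('a \<times> bool) list \<Rightarrow> ('a \<times> bool) list" where
  "red_cons x w = (case w of [] \<Rightarrow> [x]
     | y # w' \<Rightarrow> (if fst y = fst x \<and> snd y \<noteq> snd x then w' else x # w))"

definition reduce :: "('a \<times> bool) list \<Rightarrow> ('a \<times> bool) list" where
  "reduce w = foldr red_cons w []"

definition reduced :: "('a \<times> bool) list \<Rightarrow> bool" where
  "reduced w \<longleftrightarrow> (\<forall>i. Suc i < length w \<longrightarrow>
      \<not> (fst (w ! i) = fst (w ! Suc i) \<and> snd (w ! i) \<noteq> snd (w ! Suc i)))"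

definition free_group :: "'a set \<Rightarrow> (('a \<times> bool) list) monoid" where
  "free_group S = \<lparr> carrier = {w. set (map fst w) \<subseteq> S \<and> reduced w},
                    mult = (\<lambda>u v. reduce (u @ v)),
                    one = [] \<rparr>"

abbreviation F2 :: "((bool \<times> bool) list) monoid" where
  "F2 \<equiv> free_group (UNIV :: bool set)"

definition fgen :: "'a \<Rightarrow> ('a \<times> bool) list" where
  "fgen a = [(a, True)]"

definition second_derived :: "('a, 'b) monoid_scheme \<Rightarrow> 'a set" where
  "second_derived G = derived G (derived G (carrier G))"

definition free_metabelian2 :: "((bool \<times> bool) list set) monoid" where
  "free_metabelian2 = F2 Mod second_derived F2"

definition normal_closure :: "('a, 'b) monoid_scheme \<Rightarrow> 'a set \<Rightarrow> 'a set" where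
  "normal_closure G R = generate G (\<Union>g\<in>carrier G. \<Union>r\<in>R. {g \<otimes>\<^bsub>G\<^esub> r \<otimes>\<^bsub>G\<^esub> inv\<^bsub>G\<^esub> g})"

definition finitely_presented :: "('a, 'b) monoid_scheme \<Rightarrow> bool" where
  "finitely_presented G \<longleftrightarrow>
     (\<exists>(n::nat) R. finite R \<and> R \<subseteq> carrier (free_group {..<n}) \<and>
        G \<cong> (free_group {..<n} Mod normal_closure (free_group {..<n}) R))"

definition E2 :: "(complex \<Rightarrow> complex) set" where
  "E2 = {f. \<exists>a b. cmod a = 1 \<and> (f = (\<lambda>z. a * z + b) \<or> f = (\<lambda>z. a * cnj z + b))}"

definition SE2 :: "(complex \<Rightarrow> complex) set" where
  "SE2 = {f. \<exists>a b. cmod a = 1 \<and> f = (\<lambda>z. a * z + b)}"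

text \<open>The group E(2) with products composed left to right: \<open>(x)gh = ((x)g)h\<close>,
  i.e. \<open>g \<otimes> h = h \<circ> g\<close>.\<close>
definition E2_group :: "(complex \<Rightarrow> complex) monoid" where
  "E2_group = \<lparr> carrier = E2, mult = (\<lambda>g h. h \<circ> g), one = id \<rparr>"

text \<open>Reflection across the line through distinct points p and q.\<close>
definition reflection :: "complex \<Rightarrow> complex \<Rightarrow> complex \<Rightarrow> complex" where
  "reflection p q = (\<lambda>z. p + ((q - p) / cnj (q - p)) * cnj (z - p))"

definition alg_indep3 :: "real \<Rightarrow> real \<Rightarrow> real \<Rightarrow> bool" where
  "alg_indep3 x y z \<longleftrightarrow>
     (\<forall>(N::nat) (c :: nat \<Rightarrow> nat \<Rightarrow> nat \<Rightarrow> rat).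
        (\<Sum>i\<le>N. \<Sum>j\<le>N. \<Sum>k\<le>N. of_rat (c i j k) * x ^ i * y ^ j * z ^ k) = 0
        \<longrightarrow> (\<forall>i\<le>N. \<forall>j\<le>N. \<forall>k\<le>N. c i j k = 0))"

definition generic_triangle :: "complex \<Rightarrow> complex \<Rightarrow> complex \<Rightarrow> bool" where
  "generic_triangle A1 A2 A3 \<longleftrightarrow>
     (\<exists>k::real. k > 0 \<and> alg_indep3 (k * cmod (A2 - A3)) (k * cmod (A1 - A3)) (k * cmod (A1 - A2)))"

definition tri_refl1 :: "complex \<Rightarrow> complex \<Rightarrow> complex \<Rightarrow> complex \<Rightarrow> complex" where
  "tri_refl1 A1 A2 A3 = reflection A2 A3"
definition tri_refl2 :: "complex \<Rightarrow> complex \<Rightarrow> complex \<Rightarrow> complex \<Rightarrow> complex" where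
  "tri_refl2 A1 A2 A3 = reflection A1 A3"
definition tri_refl3 :: "complex \<Rightarrow> complex \<Rightarrow> complex \<Rightarrow> complex \<Rightarrow> complex" where
  "tri_refl3 A1 A2 A3 = reflection A1 A2"

definition triangle_group_set :: "complex \<Rightarrow> complex \<Rightarrow> complex \<Rightarrow> (complex \<Rightarrow> complex) set" where
  "triangle_group_set A1 A2 A3 =
     generate E2_group {tri_refl1 A1 A2 A3, tri_refl2 A1 A2 A3, tri_refl3 A1 A2 A3}"

definition triangle_group :: "complex \<Rightarrow> complex \<Rightarrow> complex \<Rightarrow> (complex \<Rightarrow> complex) monoid" where
  "triangle_group A1 A2 A3 = E2_group \<lparr> carrier := triangle_group_set A1 A2 A3 \<rparr>"

definition rotation_subgroup :: "complex \<Rightarrow> complex \<Rightarrow> complex \<Rightarrow> (complex \<Rightarrow> complex) monoid" where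
  "rotation_subgroup A1 A2 A3 = E2_group \<lparr> carrier := triangle_group_set A1 A2 A3 \<inter> SE2 \<rparr>"

end

theory Submission
  imports Defs
begin

text \<open>Normalise the triangle so that \<open>A2 = 0\<close> and \<open>A3 = 1\<close>.  The three reflections become
  \<open>z \<mapsto> z'\<close>, \<open>z \<mapsto> 1 - a + a z'\<close> and \<open>z \<mapsto> b z'\<close>, where the prime is complex conjugation and \<open>a\<close>, \<open>b\<close>
  have modulus 1.  A Laurent relation between \<open>a\<close> and \<open>b\<close> becomes, after clearing denominators,
  \<open>P + \<i> t Q = 0\<close> with rational polynomials \<open>P\<close>, \<open>Q\<close> in the side lengths and \<open>t\<close> proportional to the
  area; by genericity \<open>P\<close> and \<open>Q\<close> vanish identically, so the relation holds for all triangles, and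
  hence it is trivial.

  The commutator subgroup of a metabelian group generated by \<open>x\<close> and \<open>y\<close> is generated by the
  conjugates of \<open>[x, y]\<close> under \<open>x\<^sup>i y\<^sup>j\<close>.  In the rotation group these are the translations by
  \<open>a\<^sup>i b\<^sup>j \<kappa>\<close> with a fixed nonzero \<open>\<kappa>\<close>, which are linearly independent over \<open>\<int>\<close>; so the
  free metabelian group maps isomorphically onto the rotation group.

  If the triangle group were finitely presented, then finitely many of its relations between the
  three reflections would imply all others.  But the translation group \<open>\<int>[a, 1/a, b, 1/b]\<close> has
  Heisenberg extensions in which only monomial translations differing by a factor \<open>a\<^sup>m\<close> fail to commute.
  The reflections lift, every relation of length less than \<open>m - 1\<close> persists, and some
  commutator of two translations does not.\<close>

section \<open>Free groups and evaluation of words\<close>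

text \<open>The affine action on the plane is the Magnus embedding of the free metabelian group with
  special parameter values: one generator fixes 1, the other fixes 0. Independence of the two
  multipliers keeps it injective.

  A finite presentation of the triangle group comes with unknown generators and relators, so it has
  to be moved to the three reflections before relations can be compared. The groups that refute it
  are built for the reflections rather than the rotations, which avoids passing finite
  presentability to a subgroup of index 2.

  The cocycle is an antisymmetric form on Laurent polynomials that is invariant under multiplication
  by monomials and changes sign when the variables are inverted. Hence lifted rotations fix the
  centre and lifted reflections invert it. One reflection moves exponents of \<open>X\<close> by at
  most one, so a short word never makes two monomials meet that differ by the factor
  \<open>X\<close> to the power m. The translation of the commutator of the two rotations and its
  multiple by that power consist of monomials that do meet, and their commutator is the relation
  that is lost.\<close>

definition word_inv :: "('a \<times> bool) list \<Rightarrow> ('a \<times> bool) list" where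
  "word_inv w = rev (map (\<lambda>(a, s). (a, \<not> s)) w)"

text \<open>Arbitrary words are evaluated, not only reduced ones, so concatenation, inversion and
  substitution can be treated before any cancellation; \<open>word_eval_reduce\<close> shows that
  cancelling does no harm.\<close>

definition word_eval :: "('g, 'm) monoid_scheme \<Rightarrow> ('a \<Rightarrow> 'g) \<Rightarrow> ('a \<times> bool) list \<Rightarrow> 'g" where
  "word_eval K k w =
     foldr (\<lambda>(a, s) x. (if s then k a else inv\<^bsub>K\<^esub> (k a)) \<otimes>\<^bsub>K\<^esub> x) w \<one>\<^bsub>K\<^esub>"

definition word_subst :: "('a \<Rightarrow> ('b \<times> bool) list) \<Rightarrow> ('a \<times> bool) list \<Rightarrow> ('b \<times> bool) list" where
  "word_subst W v = concat (map (\<lambda>(a, s). if s then W a else word_inv (W a)) v)"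

definition letters :: "('a \<times> bool) list \<Rightarrow> 'a set" where
  "letters w = fst ` set w"

lemma letters_simps [simp]:
  "letters [] = {}"
  "letters (x # w) = insert (fst x) (letters w)"
  "letters (u @ v) = letters u \<union> letters v"
  by (auto simp: letters_def)

lemma word_inv_simps [simp]:
  "word_inv [] = []"
  "word_inv ((a, s) # w) = word_inv w @ [(a, \<not> s)]"
  by (auto simp: word_inv_def)

lemma letters_word_inv [simp]: "letters (word_inv w) = letters w"
  by (induction w) auto

lemma word_eval_simps [simp]:
  "word_eval K k [] = \<one>\<^bsub>K\<^esub>"
  "word_eval K k ((a, s) # w) = (if s then k a else inv\<^bsub>K\<^esub> (k a)) \<otimes>\<^bsub>K\<^esub> word_eval K k w"
  by (simp_all add: word_eval_def)

lemma word_subst_simps [simp]: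
  "word_subst W [] = []"
  "word_subst W ((a, s) # v) = (if s then W a else word_inv (W a)) @ word_subst W v"
  by (simp_all add: word_subst_def)

lemma letters_word_subst:
  assumes "letters v \<subseteq> S" "\<And>a. a \<in> S \<Longrightarrow> letters (W a) \<subseteq> I"
  shows "letters (word_subst W v) \<subseteq> I"
  using assms(1)
proof (induction v)
  case (Cons x v)
  then show ?case
    using assms(2) [of "fst x"] by (cases x) auto
qed simp

section \<open>Reduction of words and the group axioms of the free group\<close>

lemma reduced_Nil [simp]: "reduced []"
  by (simp add: reduced_def)

lemma reduced_single [simp]: "reduced [x]"
  by (simp add: reduced_def)

lemma reduced_Cons_Cons [simp]:
  "reduced (x # y # w) \<longleftrightarrow> \<not> (fst x = fst y \<and> snd x \<noteq> snd y) \<and> reduced (y # w)"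
  unfolding reduced_def by (auto simp: less_Suc_eq_0_disj nth_Cons split: nat.splits)

lemma reduced_ConsD: "reduced (x # w) \<Longrightarrow> reduced w"
  by (cases w) auto

lemma reduced_red_cons: "reduced w \<Longrightarrow> reduced (red_cons x w)"
  by (auto simp: red_cons_def split: list.splits dest: reduced_ConsD)

lemma reduced_foldr: "reduced z \<Longrightarrow> reduced (foldr red_cons w z)"
  by (induction w) (auto intro: reduced_red_cons)

lemma reduced_reduce: "reduced (reduce w)"
  by (simp add: reduce_def reduced_foldr)

lemma reduce_Cons: "reduce (x # w) = red_cons x (reduce w)"
  by (simp add: reduce_def)

lemma reduce_Nil [simp]: "reduce [] = []"
  by (simp add: reduce_def)

lemma reduce_reduced: "reduced w \<Longrightarrow> reduce w = w"
proof (induction w)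
  case (Cons x w)
  then show ?case
    by (cases w) (auto simp: reduce_Cons red_cons_def dest: reduced_ConsD)
qed simp

text \<open>Van der Waerden's trick: a letter acts on reduced words, and opposite letters act as
  mutually inverse permutations. Associativity of the free group then comes from composing these
  actions, with no confluence argument.\<close>

lemma red_cons_cancel:
  assumes "reduced w" "fst x = fst y" "snd x \<noteq> snd y"
  shows "red_cons x (red_cons y w) = w"
  using assms
  by (cases w; cases "tl w") (auto simp: red_cons_def prod_eq_iff)

lemma foldr_red_cons_red_cons:
  "reduced z \<Longrightarrow> foldr red_cons (red_cons x r) z = red_cons x (foldr red_cons r z)"
  by (cases r) (auto simp: red_cons_def [of x "_ # _"] red_cons_def [of x "[]"]
      reduced_foldr red_cons_cancel)

lemma foldr_reduce: "reduced z \<Longrightarrow> foldr red_cons (reduce u) z = foldr red_cons u z"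
  by (induction u) (auto simp: reduce_Cons foldr_red_cons_red_cons)

lemma reduce_append: "reduce (u @ v) = foldr red_cons u (reduce v)"
  by (simp add: reduce_def)

lemma reduce_reduce_left: "reduce (reduce u @ v) = reduce (u @ v)"
  by (simp add: reduce_append foldr_reduce reduced_reduce)

lemma reduce_reduce_right: "reduce (u @ reduce v) = reduce (u @ v)"
  by (simp add: reduce_append reduce_reduced reduced_reduce)

lemma letters_red_cons: "letters (red_cons x w) \<subseteq> insert (fst x) (letters w)"
  by (auto simp: red_cons_def split: list.splits if_splits)

lemma letters_reduce: "letters (reduce w) \<subseteq> letters w"
  by (induction w) (use letters_red_cons in \<open>fastforce simp: reduce_Cons\<close>)+

lemma reduce_word_inv_append: "reduce (word_inv w @ w @ v) = reduce v"
proof (induction w arbitrary: v)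
  case (Cons x w)
  obtain a s where x: "x = (a, s)" by force
  have "reduce (word_inv (x # w) @ (x # w) @ v)
      = foldr red_cons (word_inv w) (red_cons (a, \<not> s) (red_cons (a, s) (reduce (w @ v))))"
    by (simp add: x reduce_append reduce_Cons)
  also have "\<dots> = reduce (word_inv w @ w @ v)"
    by (simp add: red_cons_cancel reduced_reduce reduce_append reduced_foldr)
  finally show ?case
    using Cons by simp
qed simp

lemma free_group_sel [simp]:
  "w \<in> carrier (free_group S) \<longleftrightarrow> letters w \<subseteq> S \<and> reduced w"
  "u \<otimes>\<^bsub>free_group S\<^esub> v = reduce (u @ v)"
  "\<one>\<^bsub>free_group S\<^esub> = []"
  by (auto simp: free_group_def letters_def)

lemma reduce_in_free_group: "letters w \<subseteq> S \<Longrightarrow> reduce w \<in> carrier (free_group S)"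
  using letters_reduce [of w] by (auto simp: reduced_reduce)

lemma group_free_group: "group (free_group S)"
proof (rule groupI)
  fix x y z
  assume x: "x \<in> carrier (free_group S)" and "y \<in> carrier (free_group S)"
  then show "x \<otimes>\<^bsub>free_group S\<^esub> y \<in> carrier (free_group S)"
    using reduce_in_free_group [of "x @ y" S] by simp
  show "(x \<otimes>\<^bsub>free_group S\<^esub> y) \<otimes>\<^bsub>free_group S\<^esub> z = x \<otimes>\<^bsub>free_group S\<^esub> (y \<otimes>\<^bsub>free_group S\<^esub> z)"
    by (simp add: reduce_reduce_left reduce_reduce_right)
  show "\<one>\<^bsub>free_group S\<^esub> \<otimes>\<^bsub>free_group S\<^esub> x = x"
    using x by (simp add: reduce_reduced)
  have "reduce (word_inv x) \<in> carrier (free_group S)"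
    using x by (intro reduce_in_free_group) simp
  moreover have "reduce (word_inv x) \<otimes>\<^bsub>free_group S\<^esub> x = \<one>\<^bsub>free_group S\<^esub>"
    using reduce_word_inv_append [of x "[]"] by (simp add: reduce_reduce_left)
  ultimately show "\<exists>y\<in>carrier (free_group S). y \<otimes>\<^bsub>free_group S\<^esub> x = \<one>\<^bsub>free_group S\<^esub>"
    by blast
qed simp

lemma inv_fgen:
  assumes "a \<in> S"
  shows "inv\<^bsub>free_group S\<^esub> (fgen a) = [(a, False)]"
proof -
  interpret group "free_group S" by (rule group_free_group)
  show ?thesis
    by (rule inv_equality) (use assms in \<open>auto simp: fgen_def reduce_def red_cons_def\<close>)
qed

section \<open>Evaluation of words as a homomorphism\<close>

lemma word_eval_cong:
  "\<lbrakk>letters w \<subseteq> S; \<And>a. a \<in> S \<Longrightarrow> k a = k' a\<rbrakk> \<Longrightarrow> word_eval G k w = word_eval G k' w"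
  by (induction w) auto

lemma word_eval_fgen: "letters w \<subseteq> S \<Longrightarrow> word_eval (free_group S) fgen w = reduce w"
proof (induction w)
  case (Cons x w)
  obtain a s where x: "x = (a, s)" by force
  have "(if s then fgen a else inv\<^bsub>free_group S\<^esub> (fgen a)) = [(a, s)]"
    using Cons.prems by (simp add: x inv_fgen) (simp add: fgen_def)
  then show ?case
    using Cons by (simp add: x reduce_Cons reduce_append reduce_reduced reduced_reduce)
qed simp

context group
begin

context
  fixes k :: "'c \<Rightarrow> 'a" and S :: "'c set"
  assumes k: "k \<in> S \<rightarrow> carrier G"
begin

lemma word_eval_closed: "letters w \<subseteq> S \<Longrightarrow> word_eval G k w \<in> carrier G"
  by (induction w) (use k in \<open>auto simp: Pi_iff\<close>)

lemma word_eval_append: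
  "\<lbrakk>letters u \<subseteq> S; letters v \<subseteq> S\<rbrakk> \<Longrightarrow> word_eval G k (u @ v) = word_eval G k u \<otimes> word_eval G k v"
  by (induction u) (use k in \<open>auto simp: word_eval_closed m_assoc Pi_iff\<close>)

lemma word_eval_word_inv: "letters w \<subseteq> S \<Longrightarrow> word_eval G k (word_inv w) = inv (word_eval G k w)"
  by (induction w) (use k in \<open>auto simp: word_eval_closed word_eval_append inv_mult_group Pi_iff\<close>)

lemma word_eval_red_cons:
  assumes "letters (x # w) \<subseteq> S"
  shows "word_eval G k (red_cons x w) = word_eval G k (x # w)"
proof (cases "\<exists>y w'. w = y # w' \<and> fst y = fst x \<and> snd y \<noteq> snd x")
  case True
  then obtain y w' where "w = y # w'" "fst y = fst x" "snd y \<noteq> snd x" by blast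
  then have w: "w = (fst x, \<not> snd x) # w'" by (cases y) auto
  have "k (fst x) \<in> carrier G" "word_eval G k w' \<in> carrier G"
    using assms k w word_eval_closed [of w'] by auto
  then show ?thesis
    by (cases x) (auto simp: w red_cons_def simp flip: m_assoc)
next
  case False
  then show ?thesis
    by (auto simp: red_cons_def split: list.splits)
qed

lemma word_eval_reduce: "letters w \<subseteq> S \<Longrightarrow> word_eval G k (reduce w) = word_eval G k w"
proof (induction w)
  case (Cons x w)
  have "word_eval G k (red_cons x (reduce w)) = word_eval G k (x # reduce w)"
    by (rule word_eval_red_cons) (use Cons.prems letters_reduce [of w] in auto)
  then show ?case
    using Cons by (cases x) (simp add: reduce_Cons)
qed simp

lemma word_eval_hom: "word_eval G k \<in> hom (free_group S) G"
proof (rule homI)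
  fix u v
  assume u: "u \<in> carrier (free_group S)" and v: "v \<in> carrier (free_group S)"
  show "word_eval G k u \<in> carrier G"
    by (rule word_eval_closed) (use u in simp)
  show "word_eval G k (u \<otimes>\<^bsub>free_group S\<^esub> v) = word_eval G k u \<otimes> word_eval G k v"
    using word_eval_reduce [of "u @ v"] word_eval_append [of u v] u v by simp
qed

lemma word_eval_subst:
  assumes "letters v \<subseteq> J" and W: "\<And>a. a \<in> J \<Longrightarrow> letters (W a) \<subseteq> S"
  shows "word_eval G k (word_subst W v) = word_eval G (\<lambda>a. word_eval G k (W a)) v"
  using assms(1)
proof (induction v)
  case (Cons x v)
  have "letters (word_subst W v) \<subseteq> S"
    by (rule letters_word_subst) (use Cons.prems W in auto)
  then show ?case
    using Cons W by (cases x) (simp add: word_eval_append word_eval_word_inv)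
qed simp

lemma generate_eq_word_eval: "generate G (k ` S) = word_eval G k ` {w. letters w \<subseteq> S}"
proof
  show "generate G (k ` S) \<subseteq> word_eval G k ` {w. letters w \<subseteq> S}"
  proof
    fix g assume "g \<in> generate G (k ` S)"
    then show "g \<in> word_eval G k ` {w. letters w \<subseteq> S}"
    proof (induction rule: generate.induct)
      case one
      show ?case by (rule image_eqI [of _ _ "[]"]) auto
    next
      case (incl h)
      then obtain a where "a \<in> S" "h = k a" by blast
      then show ?case
        using k by (intro image_eqI [of _ _ "[(a, True)]"]) (auto simp: Pi_iff)
    next
      case (inv h)
      then obtain a where "a \<in> S" "h = k a" by blast
      then show ?case
        using k by (intro image_eqI [of _ _ "[(a, False)]"]) (auto simp: Pi_iff)
    next
      case (eng g h)
      then obtain u v where "letters u \<subseteq> S" "g = word_eval G k u"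
        "letters v \<subseteq> S" "h = word_eval G k v" by blast
      then show ?case
        by (intro image_eqI [of _ _ "u @ v"]) (auto simp: word_eval_append)
    qed
  qed
next
  have "word_eval G k w \<in> generate G (k ` S)" if "letters w \<subseteq> S" for w
    using that
    by (induction w) (auto simp: generate.one generate.incl generate.inv intro!: generate.eng)
  then show "word_eval G k ` {w. letters w \<subseteq> S} \<subseteq> generate G (k ` S)"
    by blast
qed

end

lemma normal_closure_normal:
  assumes "R \<subseteq> carrier G"
  shows "normal_closure G R \<lhd> G"
  unfolding normal_closure_def
proof (rule normal_generateI)
  show "(\<Union>g\<in>carrier G. \<Union>r\<in>R. {g \<otimes> r \<otimes> inv g}) \<subseteq> carrier G"
    using assms by auto
  fix h g
  assume "h \<in> (\<Union>g\<in>carrier G. \<Union>r\<in>R. {g \<otimes> r \<otimes> inv g})" and g: "g \<in> carrier G"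
  then obtain g' r where h: "g' \<in> carrier G" "r \<in> R" "h = g' \<otimes> r \<otimes> inv g'"
    by blast
  have "g \<otimes> h \<otimes> inv g = (g \<otimes> g') \<otimes> r \<otimes> inv (g \<otimes> g')"
    using h g assms by (auto simp: m_assoc inv_mult_group)
  then show "g \<otimes> h \<otimes> inv g \<in> (\<Union>g\<in>carrier G. \<Union>r\<in>R. {g \<otimes> r \<otimes> inv g})"
    using h g by blast
qed

end

lemma (in group_hom) normal_closure_subset_kernel:
  assumes "R \<subseteq> kernel G H h"
  shows "normal_closure G R \<subseteq> kernel G H h"
  unfolding normal_closure_def
proof (rule G.generate_subgroup_incl [OF _ subgroup_kernel])
  show "(\<Union>g\<in>carrier G. \<Union>r\<in>R. {g \<otimes> r \<otimes> inv g}) \<subseteq> kernel G H h"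
    using assms by (auto simp: kernel_def)
qed

section \<open>Finite presentability does not depend on the generators\<close>

text \<open>Tietze transformations carry an unknown finite presentation over to the given
  generators. The group presented by \<open>\<Phi>\<close> is never constructed; the last conclusion
  states its universal property for target groups over one fixed type.\<close>

lemma finitely_presented_finite_relations:
  fixes G :: "('g, 'm) monoid_scheme" and f :: "'i \<Rightarrow> 'g"
  assumes "group G" and "finite I" and f: "f \<in> I \<rightarrow> carrier G"
    and gen: "carrier G = generate G (f ` I)" and "finitely_presented G"
  obtains \<Phi> where "finite \<Phi>"
    and "\<And>w. w \<in> \<Phi> \<Longrightarrow> letters w \<subseteq> I \<and> word_eval G f w = \<one>\<^bsub>G\<^esub>"
    and "\<And>(K :: 'k monoid) k w. \<lbrakk>group K; k \<in> I \<rightarrow> carrier K; \<And>v. v \<in> \<Phi> \<Longrightarrow> word_eval K k v = \<one>\<^bsub>K\<^esub>;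
           letters w \<subseteq> I; word_eval G f w = \<one>\<^bsub>G\<^esub>\<rbrakk> \<Longrightarrow> word_eval K k w = \<one>\<^bsub>K\<^esub>"
proof -
  interpret G: group G by fact
  obtain n :: nat and R where R: "finite R" "R \<subseteq> carrier (free_group {..<n})"
    and iso: "G \<cong> free_group {..<n} Mod normal_closure (free_group {..<n}) R"
    using \<open>finitely_presented G\<close> unfolding finitely_presented_def by blast
  define F where "F = free_group {..<n}"
  define N where "N = normal_closure F R"
  interpret F: group F unfolding F_def by (rule group_free_group)
  interpret N: normal N F
    unfolding N_def using R by (intro F.normal_closure_normal) (simp add: F_def)
  interpret Q: group "F Mod N" by (rule N.factorgroup_is_group)
  obtain \<theta> where \<theta>: "\<theta> \<in> iso (F Mod N) G"
    using G.iso_sym [of "F Mod N"] iso by (auto simp: F_def N_def is_iso_def)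
  define \<pi> where "\<pi> v = \<theta> (N #>\<^bsub>F\<^esub> v)" for v
  have \<theta>_hom: "\<theta> \<in> hom (F Mod N) G" and \<theta>_bij: "bij_betw \<theta> (carrier (F Mod N)) (carrier G)"
    using \<theta> by (auto simp: iso_def)
  have "\<theta> \<circ> (\<lambda>v. N #>\<^bsub>F\<^esub> v) \<in> hom F G"
    by (rule hom_compose [OF N.r_coset_hom_Mod \<theta>_hom])
  then have \<pi>_hom: "\<pi> \<in> hom F G"
    by (simp add: \<pi>_def [abs_def] o_def)
  interpret \<pi>: group_hom F G \<pi>
    by unfold_locales (rule \<pi>_hom)
  have \<pi>_ker: "v \<in> N" if "v \<in> carrier F" "\<pi> v = \<one>\<^bsub>G\<^esub>" for v
  proof -
    interpret \<theta>: group_hom "F Mod N" G \<theta>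
      by unfold_locales (rule \<theta>_hom)
    have "\<theta> (N #>\<^bsub>F\<^esub> v) = \<theta> \<one>\<^bsub>F Mod N\<^esub>"
      using that by (simp add: \<pi>_def del: one_FactGroup)
    moreover have "N #>\<^bsub>F\<^esub> v \<in> carrier (F Mod N)"
      using that by (auto simp: carrier_FactGroup)
    ultimately have "N #>\<^bsub>F\<^esub> v = N"
      using \<theta>_bij Q.one_closed unfolding bij_betw_def inj_on_def by (metis one_FactGroup)
    then show "v \<in> N"
      using that F.coset_join1 N.is_subgroup by (simp add: N.subset)
  qed
  have \<pi>_N: "\<pi> v = \<one>\<^bsub>G\<^esub>" if "v \<in> N" for v
  proof -
    interpret \<theta>: group_hom "F Mod N" G \<theta>
      by unfold_locales (rule \<theta>_hom)
    have "N #>\<^bsub>F\<^esub> v = \<one>\<^bsub>F Mod N\<^esub>"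
      using that N.rcos_const by simp
    then show ?thesis
      unfolding \<pi>_def by (metis \<theta>.hom_one)
  qed
  have \<pi>_surj: "\<exists>v\<in>carrier F. \<pi> v = g" if g: "g \<in> carrier G" for g
  proof -
    obtain C where "C \<in> carrier (F Mod N)" "\<theta> C = g"
      using g unfolding bij_betw_imp_surj_on [OF \<theta>_bij, symmetric] by (rule imageE) simp
    moreover obtain v where "v \<in> carrier F" "C = N #>\<^bsub>F\<^esub> v"
      using \<open>C \<in> carrier (F Mod N)\<close> unfolding carrier_FactGroup by (rule imageE)
    ultimately show ?thesis
      by (auto simp: \<pi>_def)
  qed
  have \<pi>_fgen: "(\<lambda>j. \<pi> (fgen j)) \<in> {..<n} \<rightarrow> carrier G"
    unfolding F_def [symmetric] by (auto intro!: \<pi>.hom_closed) (simp add: F_def fgen_def)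
  have \<pi>_eval: "\<pi> (reduce v) = word_eval G (\<lambda>j. \<pi> (fgen j)) v" if "letters v \<subseteq> {..<n}" for v
    using that
  proof (induction v)
    case Nil
    then show ?case using \<pi>.hom_one by (simp add: F_def)
  next
    case (Cons x v)
    obtain j s where x: "x = (j, s)" by force
    have j: "fgen j \<in> carrier F" and letter: "(if s then fgen j else inv\<^bsub>F\<^esub> (fgen j)) = [(j, s)]"
      using Cons.prems by (simp_all add: x F_def inv_fgen) (simp_all add: fgen_def)
    have v: "reduce v \<in> carrier F"
      using Cons.prems unfolding F_def by (intro reduce_in_free_group) auto
    have "reduce (x # v) = (if s then fgen j else inv\<^bsub>F\<^esub> (fgen j)) \<otimes>\<^bsub>F\<^esub> reduce v"
      unfolding letter by (simp add: F_def x reduce_Cons reduce_reduced reduced_reduce)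
    then have "\<pi> (reduce (x # v)) = \<pi> (if s then fgen j else inv\<^bsub>F\<^esub> (fgen j)) \<otimes>\<^bsub>G\<^esub> \<pi> (reduce v)"
      using j v by simp
    then show ?case
      using Cons j by (auto simp: x)
  qed
  have "\<forall>j\<in>{..<n}. \<exists>w. letters w \<subseteq> I \<and> \<pi> (fgen j) = word_eval G f w"
  proof
    fix j assume "j \<in> {..<n}"
    then have "\<pi> (fgen j) \<in> carrier G"
      using \<pi>_fgen by auto
    then show "\<exists>w. letters w \<subseteq> I \<and> \<pi> (fgen j) = word_eval G f w"
      using gen G.generate_eq_word_eval [OF f] by auto
  qed
  then obtain W where W: "\<And>j. j < n \<Longrightarrow> letters (W j) \<subseteq> I"
    and \<pi>_W: "\<And>j. j < n \<Longrightarrow> \<pi> (fgen j) = word_eval G f (W j)"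
    by (metis lessThan_iff)
  have "\<forall>i\<in>I. \<exists>v\<in>carrier F. \<pi> v = f i"
    using f \<pi>_surj by blast
  then obtain V where V: "\<And>i. i \<in> I \<Longrightarrow> V i \<in> carrier F" and \<pi>_V: "\<And>i. i \<in> I \<Longrightarrow> \<pi> (V i) = f i"
    by metis
  have V_letters: "letters (V i) \<subseteq> {..<n}" and V_reduced: "reduced (V i)" if "i \<in> I" for i
    using V [OF that] by (auto simp: F_def)
  have subst_W: "letters (word_subst W v) \<subseteq> I" if "letters v \<subseteq> {..<n}" for v
    by (rule letters_word_subst [OF that]) (use W in blast)
  have eval_subst_W: "word_eval K k (word_subst W v) = word_eval K (\<lambda>j. word_eval K k (W j)) v"
    if "group K" "k \<in> I \<rightarrow> carrier K" "letters v \<subseteq> {..<n}" for K :: "('x, 'y) monoid_scheme" and k v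
    by (rule group.word_eval_subst [OF that]) (use W in blast)
  have eval_subst_W_G: "word_eval G f (word_subst W v) = \<pi> (reduce v)" if "letters v \<subseteq> {..<n}" for v
    using eval_subst_W [OF \<open>group G\<close> f that] \<pi>_eval [OF that]
      word_eval_cong [OF that, of "\<lambda>j. \<pi> (fgen j)" "\<lambda>j. word_eval G f (W j)" G] \<pi>_W by auto
  \<comment> \<open>The old relators are rewritten in the letters \<open>I\<close>. The second
    family says that expressing the generator \<open>i\<close> through the generators of the
    presentation and translating back returns \<open>i\<close>.\<close>
  define \<Phi> where "\<Phi> = word_subst W ` R \<union> (\<lambda>i. (i, False) # word_subst W (V i)) ` I"
  show thesis
  proof
    show "finite \<Phi>"
      using R \<open>finite I\<close> by (simp add: \<Phi>_def)
    show "letters w \<subseteq> I \<and> word_eval G f w = \<one>\<^bsub>G\<^esub>" if "w \<in> \<Phi>" for w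
      using that unfolding \<Phi>_def
    proof
      assume "w \<in> word_subst W ` R"
      then obtain r where r: "r \<in> R" "w = word_subst W r" by blast
      then have rF: "r \<in> carrier F"
        using subsetD [OF R(2)] by (simp add: F_def)
      have "\<one>\<^bsub>F\<^esub> \<otimes>\<^bsub>F\<^esub> r \<otimes>\<^bsub>F\<^esub> inv\<^bsub>F\<^esub> \<one>\<^bsub>F\<^esub> \<in> N"
        unfolding N_def normal_closure_def using r by (intro generate.incl) blast
      then have "\<pi> r = \<one>\<^bsub>G\<^esub>"
        using rF \<pi>_N by (simp del: free_group_sel)
      then show ?thesis
        using rF r subst_W eval_subst_W_G [of r] by (simp add: F_def reduce_reduced)
    next
      assume "w \<in> (\<lambda>i. (i, False) # word_subst W (V i)) ` I"
      then obtain i where i: "i \<in> I" "w = (i, False) # word_subst W (V i)" by blast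
      then show ?thesis
        using subst_W [OF V_letters] eval_subst_W_G [OF V_letters] V_reduced \<pi>_V funcset_mem [OF f]
        by (auto simp: reduce_reduced)
    qed
    fix K :: "'k monoid" and k w
    assume K: "group K" and k: "k \<in> I \<rightarrow> carrier K" and rel: "\<And>v. v \<in> \<Phi> \<Longrightarrow> word_eval K k v = \<one>\<^bsub>K\<^esub>"
      and w: "letters w \<subseteq> I" "word_eval G f w = \<one>\<^bsub>G\<^esub>"
    interpret K: group K by fact
    define k' where "k' j = word_eval K k (W j)" for j
    have k': "k' \<in> {..<n} \<rightarrow> carrier K"
      unfolding k'_def using K.word_eval_closed [OF k W] by auto
    interpret ev: group_hom F K "word_eval K k'"
      by unfold_locales (unfold F_def, rule K.word_eval_hom [OF k'])
    have "word_eval K k' r = \<one>\<^bsub>K\<^esub>" if "r \<in> R" for r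
    proof -
      have "letters r \<subseteq> {..<n}"
        using subsetD [OF R(2) that] by simp
      then show ?thesis
        using eval_subst_W [OF K k, of r] rel [of "word_subst W r"] that
        by (simp add: \<Phi>_def k'_def [abs_def])
    qed
    then have "N \<subseteq> kernel F K (word_eval K k')"
      unfolding N_def by (intro ev.normal_closure_subset_kernel) (use subsetD [OF R(2)] in \<open>auto simp: kernel_def F_def\<close>)
    then have ev_N: "word_eval K k' v = \<one>\<^bsub>K\<^esub>" if "v \<in> N" for v
      using that by (auto simp: kernel_def)
    have k_V: "word_eval K k' (V i) = k i" if "i \<in> I" for i
    proof -
      have ki: "k i \<in> carrier K"
        using that k by blast
      have mem: "word_eval K k' (V i) \<in> carrier K"
        by (rule K.word_eval_closed [OF k' V_letters [OF that]])
      have "inv\<^bsub>K\<^esub> (k i) \<otimes>\<^bsub>K\<^esub> word_eval K k' (V i) = \<one>\<^bsub>K\<^esub>"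
        using rel [of "(i, False) # word_subst W (V i)"] that eval_subst_W [OF K k V_letters [OF that]]
        by (simp add: \<Phi>_def k'_def [abs_def])
      then show ?thesis
        using ki mem by (metis K.inv_closed K.inv_inv K.inv_solve_left K.r_one K.one_closed)
    qed
    \<comment> \<open>Translated by \<open>V\<close>, the relation \<open>w\<close> becomes an
      element of \<open>N\<close>. Evaluation at \<open>k'\<close> kills \<open>N\<close> and sends
      each \<open>V i\<close> back to \<open>k i\<close>, so it also computes the value of
      \<open>w\<close> at \<open>k\<close>.\<close>
    have Vw: "letters (word_subst V w) \<subseteq> {..<n}"
      by (rule letters_word_subst [OF w(1) V_letters])
    have "\<pi> (reduce (word_subst V w)) = word_eval G (\<lambda>i. word_eval G (\<lambda>j. \<pi> (fgen j)) (V i)) w"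
      unfolding \<pi>_eval [OF Vw]
      by (rule G.word_eval_subst [OF \<pi>_fgen w(1) V_letters])
    also have "\<dots> = word_eval G f w"
      by (rule word_eval_cong [OF w(1)]) (simp add: reduce_reduced V_reduced \<pi>_V flip: \<pi>_eval [OF V_letters])
    finally have "reduce (word_subst V w) \<in> N"
      using w reduce_in_free_group [OF Vw] by (intro \<pi>_ker) (auto simp: F_def simp del: free_group_sel)
    then have "\<one>\<^bsub>K\<^esub> = word_eval K k' (word_subst V w)"
      using ev_N K.word_eval_reduce [OF k' Vw] by simp
    also have "\<dots> = word_eval K (\<lambda>i. word_eval K k' (V i)) w"
      by (rule K.word_eval_subst [OF k' w(1) V_letters])
    also have "\<dots> = word_eval K k w"
      by (rule word_eval_cong [OF w(1) k_V])
    finally show "word_eval K k w = \<one>\<^bsub>K\<^esub>" by simp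
  qed
qed

section \<open>Algebraic independence of the rotation angles\<close>

text \<open>Polynomial functions given by closure rules, so that membership is a matter of
  introduction rules. The coefficient arrays of \<open>alg_indep3\<close> are recovered only once,
  through lists of monomials.\<close>

inductive rat_poly3 :: "(real \<Rightarrow> real \<Rightarrow> real \<Rightarrow> real) \<Rightarrow> bool" where
  const: "rat_poly3 (\<lambda>x y z. of_rat c)"
| fst: "rat_poly3 (\<lambda>x y z. x)"
| snd: "rat_poly3 (\<lambda>x y z. y)"
| thd: "rat_poly3 (\<lambda>x y z. z)"
| add: "\<lbrakk>rat_poly3 f; rat_poly3 g\<rbrakk> \<Longrightarrow> rat_poly3 (\<lambda>x y z. f x y z + g x y z)"
| mult: "\<lbrakk>rat_poly3 f; rat_poly3 g\<rbrakk> \<Longrightarrow> rat_poly3 (\<lambda>x y z. f x y z * g x y z)"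

definition monomials_eval :: "(rat \<times> nat \<times> nat \<times> nat) list \<Rightarrow> real \<Rightarrow> real \<Rightarrow> real \<Rightarrow> real" where
  "monomials_eval ms x y z = (\<Sum>(c, i, j, k)\<leftarrow>ms. of_rat c * x ^ i * y ^ j * z ^ k)"

lemma monomials_eval_simps [simp]:
  "monomials_eval [] x y z = 0"
  "monomials_eval ((c, i, j, k) # ms) x y z = of_rat c * x ^ i * y ^ j * z ^ k + monomials_eval ms x y z"
  "monomials_eval (ms @ ns) x y z = monomials_eval ms x y z + monomials_eval ns x y z"
  by (simp_all add: monomials_eval_def)

lemma monomials_eval_scale:
  "monomials_eval (map (\<lambda>(c', i', j', k'). (c * c', i + i', j + j', k + k')) ms) x y z
   = of_rat c * x ^ i * y ^ j * z ^ k * monomials_eval ms x y z"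
  by (induction ms) (auto simp: of_rat_mult power_add algebra_simps)

lemma monomials_eval_mult:
  "monomials_eval (concat (map (\<lambda>(c, i, j, k).
      map (\<lambda>(c', i', j', k'). (c * c', i + i', j + j', k + k')) ns) ms)) x y z
   = monomials_eval ms x y z * monomials_eval ns x y z"
  by (induction ms) (auto simp: monomials_eval_scale algebra_simps)

lemma rat_poly3_monomials:
  assumes "rat_poly3 f"
  obtains ms where "f = monomials_eval ms"
proof -
  have "\<exists>ms. f = monomials_eval ms"
    using assms
  proof induction
    case (const c)
    show ?case by (rule exI [of _ "[(c, 0, 0, 0)]"]) (simp add: fun_eq_iff)
  next
    case fst
    show ?case by (rule exI [of _ "[(1, 1, 0, 0)]"]) (simp add: fun_eq_iff)
  next
    case snd
    show ?case by (rule exI [of _ "[(1, 0, 1, 0)]"]) (simp add: fun_eq_iff)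
  next
    case thd
    show ?case by (rule exI [of _ "[(1, 0, 0, 1)]"]) (simp add: fun_eq_iff)
  next
    case (add f g)
    then obtain ms ns where "f = monomials_eval ms" "g = monomials_eval ns" by blast
    then show ?case by (intro exI [of _ "ms @ ns"]) (simp add: fun_eq_iff)
  next
    case (mult f g)
    then obtain ms ns where "f = monomials_eval ms" "g = monomials_eval ns" by blast
    then show ?case
      by (intro exI [of _ "concat (map (\<lambda>(c, i, j, k).
          map (\<lambda>(c', i', j', k'). (c * c', i + i', j + j', k + k')) ns) ms)"])
        (simp add: fun_eq_iff monomials_eval_mult)
  qed
  then show thesis using that by blast
qed

text \<open>A list may mention the same monomial several times, so its coefficient is the sum over
  all occurrences.\<close>

lemma monomials_eval_collect:
  assumes "\<And>c i j k. (c, i, j, k) \<in> set ms \<Longrightarrow> i \<le> N \<and> j \<le> N \<and> k \<le> N"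
  shows "monomials_eval ms x y z = (\<Sum>i\<le>N. \<Sum>j\<le>N. \<Sum>k\<le>N.
           of_rat (\<Sum>(c, m)\<leftarrow>ms. if m = (i, j, k) then c else 0) * x ^ i * y ^ j * z ^ k)"
  using assms
proof (induction ms)
  case (Cons m ms)
  obtain c i' j' k' where m: "m = (c, i', j', k')" by (cases m) auto
  then have le: "i' \<le> N" "j' \<le> N" "k' \<le> N"
    using Cons.prems by auto
  have "(\<Sum>i\<le>N. \<Sum>j\<le>N. \<Sum>k\<le>N. of_rat (if (i', j', k') = (i, j, k) then c else 0) * x ^ i * y ^ j * z ^ k)
      = (\<Sum>i\<le>N. \<Sum>j\<le>N. \<Sum>k\<le>N. if k = k' then (if j = j' then (if i = i' then of_rat c * x ^ i * y ^ j * z ^ k else 0) else 0) else 0)"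
    by (intro sum.cong) auto
  also have "\<dots> = of_rat c * x ^ i' * y ^ j' * z ^ k'"
    using le by simp
  finally show ?case
    using Cons.IH Cons.prems unfolding m
    by (simp add: of_rat_add distrib_right sum.distrib) (metis prod.inject)
qed simp

lemma alg_indep3_rat_poly3_zero:
  assumes indep: "alg_indep3 x y z" and "rat_poly3 f" and "f x y z = 0"
  shows "f x' y' z' = 0"
proof -
  obtain ms where f: "f = monomials_eval ms"
    using \<open>rat_poly3 f\<close> by (rule rat_poly3_monomials)
  define N where "N = (\<Sum>(c, i, j, k)\<leftarrow>ms. i + j + k)"
  have N: "i \<le> N \<and> j \<le> N \<and> k \<le> N" if "(c, i, j, k) \<in> set ms" for c i j k
    using member_le_sum_list [of "i + j + k" "map (\<lambda>(c, i, j, k). i + j + k) ms"] that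
    unfolding N_def by force
  define C where "C i j k = (\<Sum>(c, m)\<leftarrow>ms. if m = (i, j, k) then c else 0)" for i j k
  have eval: "f u v w = (\<Sum>i\<le>N. \<Sum>j\<le>N. \<Sum>k\<le>N. of_rat (C i j k) * u ^ i * v ^ j * w ^ k)" for u v w
    unfolding f C_def by (rule monomials_eval_collect) (use N in blast)
  have "\<forall>i\<le>N. \<forall>j\<le>N. \<forall>k\<le>N. C i j k = 0"
    using indep assms(3) unfolding alg_indep3_def eval by blast
  then show ?thesis
    unfolding eval by simp
qed

text \<open>\<open>u = (x\<^sup>2 + z\<^sup>2 - y\<^sup>2)/2\<close> and \<open>t\<close> are the coordinates of the apex, scaled by the base,
  of a triangle with side lengths \<open>x, y, z\<close>.  A complex number obtained polynomially from the
  side lengths, \<open>u\<close> and \<open>\<i> t\<close> is of the form \<open>P + \<i> t Q\<close> by Heron's relation for \<open>t\<^sup>2\<close>.\<close>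

definition apex :: "real \<Rightarrow> real \<Rightarrow> real \<Rightarrow> real" where
  "apex x y z = (x\<^sup>2 + z\<^sup>2 - y\<^sup>2) / 2"

definition heron :: "real \<Rightarrow> real \<Rightarrow> real \<Rightarrow> real \<Rightarrow> bool" where
  "heron x y z t \<longleftrightarrow> t\<^sup>2 = x\<^sup>2 * z\<^sup>2 - (apex x y z)\<^sup>2"

definition heron_form :: "(real \<Rightarrow> real \<Rightarrow> real \<Rightarrow> real \<Rightarrow> complex) \<Rightarrow> bool" where
  "heron_form F \<longleftrightarrow> (\<exists>P Q. rat_poly3 P \<and> rat_poly3 Q \<and>
     (\<forall>x y z t. heron x y z t \<longrightarrow> F x y z t = Complex (P x y z) (t * Q x y z)))"

lemma rat_poly3_of_int: "rat_poly3 (\<lambda>x y z. of_int m)"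
  using rat_poly3.const [of "of_int m"] by simp

lemma rat_poly3_diff:
  assumes "rat_poly3 f" "rat_poly3 g" shows "rat_poly3 (\<lambda>x y z. f x y z - g x y z)"
  using rat_poly3.add [OF assms(1) rat_poly3.mult [OF rat_poly3_of_int [of "-1"] assms(2)]] by simp

lemma rat_poly3_power: "rat_poly3 f \<Longrightarrow> rat_poly3 (\<lambda>x y z. f x y z ^ n)"
  by (induction n) (use rat_poly3_of_int [of 1] in \<open>auto intro: rat_poly3.mult\<close>)

lemma rat_poly3_apex: "rat_poly3 apex"
proof -
  have "rat_poly3 (\<lambda>x y z. of_rat (1/2) * (x\<^sup>2 + z\<^sup>2 - y\<^sup>2))"
    by (intro rat_poly3.mult rat_poly3.const rat_poly3_diff rat_poly3.add rat_poly3_power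
        rat_poly3.fst rat_poly3.snd rat_poly3.thd)
  then show ?thesis
    by (simp add: apex_def [abs_def] of_rat_divide)
qed

lemma heron_form_real: "rat_poly3 P \<Longrightarrow> heron_form (\<lambda>x y z t. of_real (P x y z))"
  unfolding heron_form_def using rat_poly3_of_int [of 0] by (force simp: complex_eq_iff)

lemma heron_form_it: "heron_form (\<lambda>x y z t. \<i> * of_real t)"
  unfolding heron_form_def
  by (rule exI [of _ "\<lambda>x y z. 0"], rule exI [of _ "\<lambda>x y z. 1"])
     (use rat_poly3_of_int [of 0] rat_poly3_of_int [of 1] in \<open>simp add: complex_eq_iff\<close>)

lemma heron_form_add:
  assumes "heron_form F" "heron_form F'"
  shows "heron_form (\<lambda>x y z t. F x y z t + F' x y z t)"
proof -
  obtain P Q P' Q' where pol: "rat_poly3 P" "rat_poly3 Q" "rat_poly3 P'" "rat_poly3 Q'"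
    and F: "\<And>x y z t. heron x y z t \<Longrightarrow> F x y z t = Complex (P x y z) (t * Q x y z)"
    and F': "\<And>x y z t. heron x y z t \<Longrightarrow> F' x y z t = Complex (P' x y z) (t * Q' x y z)"
    using assms unfolding heron_form_def by blast
  show ?thesis
    unfolding heron_form_def
    by (rule exI, rule exI, intro conjI allI impI, rule rat_poly3.add [OF pol(1,3)], rule rat_poly3.add [OF pol(2,4)])
       (simp add: F F' complex_eq_iff algebra_simps)
qed

lemma heron_form_mult:
  assumes "heron_form F" "heron_form F'"
  shows "heron_form (\<lambda>x y z t. F x y z t * F' x y z t)"
proof -
  obtain P Q P' Q' where pol: "rat_poly3 P" "rat_poly3 Q" "rat_poly3 P'" "rat_poly3 Q'"
    and F: "\<And>x y z t. heron x y z t \<Longrightarrow> F x y z t = Complex (P x y z) (t * Q x y z)"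
    and F': "\<And>x y z t. heron x y z t \<Longrightarrow> F' x y z t = Complex (P' x y z) (t * Q' x y z)"
    using assms unfolding heron_form_def by blast
  define P'' where "P'' x y z = P x y z * P' x y z - (x\<^sup>2 * z\<^sup>2 - (apex x y z)\<^sup>2) * (Q x y z * Q' x y z)" for x y z
  define Q'' where "Q'' x y z = P x y z * Q' x y z + Q x y z * P' x y z" for x y z
  have "rat_poly3 P''" "rat_poly3 Q''"
    unfolding P''_def [abs_def] Q''_def [abs_def]
    by (intro rat_poly3.mult rat_poly3_diff rat_poly3.add rat_poly3_power pol
        rat_poly3.fst rat_poly3.thd rat_poly3_apex)+
  moreover have "F x y z t * F' x y z t = Complex (P'' x y z) (t * Q'' x y z)" if "heron x y z t" for x y z t
  proof -
    have "P'' x y z = P x y z * P' x y z - t\<^sup>2 * (Q x y z * Q' x y z)"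
      using that by (simp add: P''_def heron_def)
    then show ?thesis
      by (simp add: F [OF that] F' [OF that] Q''_def complex_eq_iff power2_eq_square algebra_simps)
  qed
  ultimately show ?thesis
    unfolding heron_form_def by blast
qed

lemma heron_form_power: "heron_form F \<Longrightarrow> heron_form (\<lambda>x y z t. F x y z t ^ n)"
  by (induction n) (use heron_form_real [OF rat_poly3_of_int [of 1]] in \<open>auto intro: heron_form_mult\<close>)

lemma heron_form_sum:
  "finite A \<Longrightarrow> (\<And>a. a \<in> A \<Longrightarrow> heron_form (F a)) \<Longrightarrow> heron_form (\<lambda>x y z t. \<Sum>a\<in>A. F a x y z t)"
  by (induction A rule: finite_induct)
     (use heron_form_real [OF rat_poly3_of_int [of 0]] in \<open>auto intro: heron_form_add\<close>)

text \<open>Since \<open>t\<close> is real and nonzero, the real part \<open>P\<close> and the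
  imaginary part \<open>t * Q\<close> vanish separately. Two rational polynomials thus vanish at an
  independent triple, hence everywhere. The target triple may be degenerate, with
  \<open>t' = 0\<close>.\<close>

lemma heron_form_specialize:
  assumes "heron_form F" "alg_indep3 x y z" "heron x y z t" "t \<noteq> 0" "F x y z t = 0" "heron x' y' z' t'"
  shows "F x' y' z' t' = 0"
proof -
  obtain P Q where pol: "rat_poly3 P" "rat_poly3 Q"
    and F: "\<And>x y z t. heron x y z t \<Longrightarrow> F x y z t = Complex (P x y z) (t * Q x y z)"
    using assms(1) unfolding heron_form_def by blast
  have "P x y z = 0" "Q x y z = 0"
    using F [OF assms(3)] assms(4,5) by (auto simp: complex_eq_iff)
  then have "P x' y' z' = 0" "Q x' y' z' = 0"
    using alg_indep3_rat_poly3_zero [OF assms(2)] pol by blast+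
  then show ?thesis
    using F [OF assms(6)] by (simp add: complex_eq_iff)
qed

text \<open>The square of the direction of \<open>w\<close>, which is the linear factor of the
  reflection across a line parallel to \<open>w\<close>. It does not change when \<open>w\<close> is
  multiplied by a nonzero real number.\<close>

definition unit_square :: "complex \<Rightarrow> complex" where
  "unit_square w = w / cnj w"

lemma unit_square_eq: "w \<noteq> 0 \<Longrightarrow> unit_square w = w\<^sup>2 / (of_real (cmod w))\<^sup>2"
  using complex_norm_square [of w] by (simp add: unit_square_def field_simps power2_eq_square)

text \<open>A polynomial relation between \<open>unit_square (1 - w)\<close> and
  \<open>unit_square w\<close> with denominators cleared by \<open>(x * y) ^ (2 * N)\<close> and
  \<open>(x * z) ^ (2 * N)\<close>. The two bases stand for the sides \<open>1 - w\<close> and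
  \<open>w\<close> scaled by the square of \<open>r\<close>. The minus sign is written as a factor
  -1, so that closure under sums and products is enough.\<close>

definition angle_relation ::
    "nat \<Rightarrow> (nat \<Rightarrow> nat \<Rightarrow> int) \<Rightarrow> real \<Rightarrow> real \<Rightarrow> real \<Rightarrow> real \<Rightarrow> complex" where
  "angle_relation N n x y z t = (\<Sum>i\<le>N. \<Sum>j\<le>N. of_int (n i j) *
     ((of_real (x\<^sup>2 - apex x y z) + of_real (-1) * (\<i> * of_real t)) ^ (2 * i) * of_real (x * y) ^ (2 * (N - i)) *
     ((of_real (apex x y z) + \<i> * of_real t) ^ (2 * j) * of_real (x * z) ^ (2 * (N - j)))))"

lemma heron_form_angle_relation: "heron_form (angle_relation N n)"
proof -
  have int: "heron_form (\<lambda>x y z t. of_int m)" for m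
    using heron_form_real [OF rat_poly3_of_int [of m]] by simp
  have neg: "heron_form (\<lambda>x y z t. of_real (-1))"
    using heron_form_real [OF rat_poly3_of_int [of "-1"]] by simp
  show ?thesis
    unfolding angle_relation_def [abs_def]
    by (intro heron_form_sum heron_form_add heron_form_mult heron_form_power heron_form_real
        heron_form_it rat_poly3_apex rat_poly3.mult rat_poly3_diff rat_poly3_power
        rat_poly3.fst rat_poly3.snd rat_poly3.thd int neg finite_atMost)
qed

context
  fixes w :: complex and r x y z t :: real
  assumes w: "w \<noteq> 0" "w \<noteq> 1" and r: "r > 0"
    and x: "x = r" and y: "y = r * cmod (1 - w)" and z: "z = r * cmod w" and t: "t = r\<^sup>2 * Im w"
begin

text \<open>The triangle has corners 0, \<open>r\<close> and \<open>r * w\<close>. Its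
  \<open>apex\<close> value is the inner product of the two sides at 0, and \<open>t\<close> is
  twice the signed area.\<close>

lemma apex_triangle: "apex x y z = r\<^sup>2 * Re w"
  unfolding apex_def x y z power_mult_distrib cmod_power2
  by (simp add: power2_eq_square algebra_simps)

lemma heron_triangle: "heron x y z t"
  unfolding heron_def apex_triangle unfolding x z t power_mult_distrib cmod_power2
  by (simp add: power2_eq_square algebra_simps)

lemma angle_relation_triangle:
  "angle_relation N n x y z t = of_real ((x * y) ^ (2 * N) * (x * z) ^ (2 * N)) *
     (\<Sum>i\<le>N. \<Sum>j\<le>N. of_int (n i j) * unit_square (1 - w) ^ i * unit_square w ^ j)"
proof -
  have 1: "of_real (x\<^sup>2 - apex x y z) + of_real (-1) * (\<i> * of_real t) = of_real (r\<^sup>2) * (1 - w)"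
    unfolding apex_triangle unfolding x t by (simp add: complex_eq_iff algebra_simps)
  have 2: "of_real (apex x y z) + \<i> * of_real t = of_real (r\<^sup>2) * w"
    unfolding apex_triangle unfolding x t by (simp add: complex_eq_iff algebra_simps)
  have pow: "(of_real (r\<^sup>2) * v) ^ (2 * i) * of_real (r * (r * cmod v)) ^ (2 * (N - i))
      = of_real ((r * (r * cmod v)) ^ (2 * N)) * unit_square v ^ i" if "i \<le> N" "v \<noteq> 0" for i v
  proof -
    have N: "2 * N = 2 * i + 2 * (N - i)" using that by simp
    have "(of_real (r\<^sup>2) * v) ^ (2 * i) = of_real (r * (r * cmod v)) ^ (2 * i) * unit_square v ^ i"
      using r that
      by (simp add: unit_square_eq power_mult_distrib power_divide power_mult field_simps power2_eq_square)
    then show ?thesis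
      unfolding N power_add by simp
  qed
  show ?thesis
    unfolding angle_relation_def 1 2 sum_distrib_left
  proof (intro sum.cong refl)
    fix i j assume "i \<in> {..N}" "j \<in> {..N}"
    then have ij: "i \<le> N" "j \<le> N" by auto
    have "1 - w \<noteq> 0" using w by simp
    then show "of_int (n i j) * ((of_real (r\<^sup>2) * (1 - w)) ^ (2 * i) * of_real (x * y) ^ (2 * (N - i)) *
        ((of_real (r\<^sup>2) * w) ^ (2 * j) * of_real (x * z) ^ (2 * (N - j)))) =
        of_real ((x * y) ^ (2 * N) * (x * z) ^ (2 * N)) *
        (of_int (n i j) * unit_square (1 - w) ^ i * unit_square w ^ j)"
      unfolding x y z pow [OF ij(1) \<open>1 - w \<noteq> 0\<close>] pow [OF ij(2) w(1)] by simp
  qed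
qed

end

text \<open>The new triangle has base 1 and may be flat, because specialisation asks only for
  Heron's relation. As \<open>v\<close> differs from 0 and 1, its sides are nonzero and the cleared
  denominators cancel again.\<close>

lemma unit_square_relation_specialize:
  assumes indep: "alg_indep3 r (r * cmod (1 - w)) (r * cmod w)" and "Im w \<noteq> 0" "r > 0"
    and rel: "(\<Sum>i\<le>N. \<Sum>j\<le>N. of_int (n i j) * unit_square (1 - w) ^ i * unit_square w ^ j) = 0"
    and v: "v \<noteq> 0" "v \<noteq> 1"
  shows "(\<Sum>i\<le>N. \<Sum>j\<le>N. of_int (n i j) * unit_square (1 - v) ^ i * unit_square v ^ j) = 0"
proof -
  have w: "w \<noteq> 0" "w \<noteq> 1" using assms by auto
  have "angle_relation N n 1 (1 * cmod (1 - v)) (1 * cmod v) (1\<^sup>2 * Im v) = 0"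
  proof (rule heron_form_specialize [OF heron_form_angle_relation indep])
    show "heron r (r * cmod (1 - w)) (r * cmod w) (r\<^sup>2 * Im w)"
      by (rule heron_triangle [OF w \<open>r > 0\<close>]) auto
    show "angle_relation N n r (r * cmod (1 - w)) (r * cmod w) (r\<^sup>2 * Im w) = 0"
      using rel angle_relation_triangle [OF w \<open>r > 0\<close> refl refl refl refl, of N n] by simp
    show "heron 1 (1 * cmod (1 - v)) (1 * cmod v) (1\<^sup>2 * Im v)"
      by (rule heron_triangle [OF v zero_less_one]) auto
  qed (use assms in auto)
  then show ?thesis
    using angle_relation_triangle [OF v zero_less_one refl refl refl refl, of N n] v by simp
qed

section \<open>Only the trivial relation holds for all triangles\<close>

lemma polyfun_infinite_roots:
  fixes c :: "nat \<Rightarrow> complex"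
  assumes "infinite A" "inj_on f A" "\<And>a. a \<in> A \<Longrightarrow> (\<Sum>i\<le>N. c i * f a ^ i) = 0" "i \<le> N"
  shows "c i = 0"
proof -
  have "infinite (f ` A)"
    using assms by (simp add: finite_image_iff)
  moreover have "f ` A \<subseteq> {z. (\<Sum>i\<le>N. c i * z ^ i) = 0}"
    using assms(3) by blast
  ultimately show ?thesis
    using assms(4) polyfun_finite_roots [of c N] finite_subset by blast
qed

text \<open>Put \<open>v = \<rho> * (1 + \<i> * \<tau>)\<close>. Moving \<open>\<rho>\<close> along
  the ray fixes \<open>unit_square v\<close> while \<open>unit_square (1 - v)\<close> takes
  infinitely many values, so the coefficient of each of its powers vanishes. These coefficients are
  polynomials in \<open>unit_square v\<close>, which takes infinitely many values as
  \<open>\<tau>\<close> varies.\<close>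

lemma unit_square_relation_trivial:
  assumes rel: "\<And>v. \<lbrakk>v \<noteq> 0; v \<noteq> 1\<rbrakk> \<Longrightarrow>
      (\<Sum>i\<le>N. \<Sum>j\<le>N. of_int (n i j) * unit_square (1 - v) ^ i * unit_square v ^ j) = (0::complex)"
    and "i \<le> N" "j \<le> N"
  shows "n i j = (0::int)"
proof -
  define e where "e \<tau> = Complex 1 \<tau>" for \<tau>
  have inner: "(\<Sum>j\<le>N. of_int (n i j) * unit_square (e \<tau>) ^ j) = 0" if "\<tau> \<in> {0<..}" for \<tau>
  proof (rule polyfun_infinite_roots [where A = "{0<..} :: real set" and N = N
        and f = "\<lambda>\<rho>. unit_square (1 - of_real \<rho> * e \<tau>)"
        and c = "\<lambda>i. \<Sum>j\<le>N. of_int (n i j) * unit_square (e \<tau>) ^ j"])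
    show "infinite ({0<..} :: real set)"
      by (rule infinite_Ioi)
    show "inj_on (\<lambda>\<rho>. unit_square (1 - of_real \<rho> * e \<tau>)) {0<..}"
    proof (rule inj_onI)
      fix \<rho> \<rho>' :: real
      assume pos: "\<rho> \<in> {0<..}" "\<rho>' \<in> {0<..}"
        and eq: "unit_square (1 - of_real \<rho> * e \<tau>) = unit_square (1 - of_real \<rho>' * e \<tau>)"
      have "cnj (1 - of_real \<rho> * e \<tau>) \<noteq> 0" "cnj (1 - of_real \<rho>' * e \<tau>) \<noteq> 0"
        using pos that by (auto simp: e_def complex_eq_iff)
      then have "(1 - of_real \<rho> * e \<tau>) * cnj (1 - of_real \<rho>' * e \<tau>) = (1 - of_real \<rho>' * e \<tau>) * cnj (1 - of_real \<rho> * e \<tau>)"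
        using eq unfolding unit_square_def by (metis frac_eq_eq)
      then have "\<tau> * \<rho> = \<tau> * \<rho>'"
        by (auto simp: e_def complex_eq_iff algebra_simps)
      then show "\<rho> = \<rho>'"
        using that by simp
    qed
    fix \<rho> :: real assume "\<rho> \<in> {0<..}"
    then have "of_real \<rho> * e \<tau> \<noteq> 0" "of_real \<rho> * e \<tau> \<noteq> 1"
      and us: "unit_square (of_real \<rho> * e \<tau>) = unit_square (e \<tau>)"
      using that by (auto simp: e_def complex_eq_iff unit_square_def)
    have "(\<Sum>i\<le>N. (\<Sum>j\<le>N. of_int (n i j) * unit_square (e \<tau>) ^ j) *
        unit_square (1 - of_real \<rho> * e \<tau>) ^ i) = (\<Sum>i\<le>N. \<Sum>j\<le>N. of_int (n i j) *
        unit_square (1 - of_real \<rho> * e \<tau>) ^ i * unit_square (of_real \<rho> * e \<tau>) ^ j)"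
      unfolding us sum_distrib_right by (intro sum.cong refl) (simp add: mult_ac)
    then show "(\<Sum>i\<le>N. (\<Sum>j\<le>N. of_int (n i j) * unit_square (e \<tau>) ^ j) *
        unit_square (1 - of_real \<rho> * e \<tau>) ^ i) = 0"
      using rel [OF \<open>of_real \<rho> * e \<tau> \<noteq> 0\<close> \<open>of_real \<rho> * e \<tau> \<noteq> 1\<close>] by simp
  qed (use assms in auto)
  have "(of_int (n i j) :: complex) = 0"
  proof (rule polyfun_infinite_roots [where A = "{0<..} :: real set" and N = N
        and f = "\<lambda>\<tau>. unit_square (e \<tau>)" and c = "\<lambda>j. of_int (n i j)"])
    show "infinite ({0<..} :: real set)"
      by (rule infinite_Ioi)
    show "inj_on (\<lambda>\<tau>. unit_square (e \<tau>)) {0<..}"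
    proof (rule inj_onI)
      fix \<tau> \<tau>' :: real
      assume eq: "unit_square (e \<tau>) = unit_square (e \<tau>')"
      have "cnj (e \<tau>) \<noteq> 0" "cnj (e \<tau>') \<noteq> 0"
        by (auto simp: e_def complex_eq_iff)
      then have "e \<tau> * cnj (e \<tau>') = e \<tau>' * cnj (e \<tau>)"
        using eq unfolding unit_square_def by (metis frac_eq_eq)
      then show "\<tau> = \<tau>'"
        by (simp add: e_def complex_eq_iff algebra_simps)
    qed
  qed (use assms inner in auto)
  then show ?thesis by simp
qed

text \<open>Algebraic independence over the rationals of two nonzero numbers, phrased as linear
  independence of monomials because the rotation group produces negative exponents.\<close>

definition laurent_independent :: "complex \<Rightarrow> complex \<Rightarrow> bool" where
  "laurent_independent a b \<longleftrightarrow> (\<forall>S n. finite S \<longrightarrow>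
     (\<Sum>(i, j)\<in>S. of_int (n (i, j)) * a powi i * b powi j) = 0 \<longrightarrow> (\<forall>u\<in>S. n u = (0::int)))"

lemma laurent_independent_if:
  assumes "a \<noteq> 0" "b \<noteq> 0"
    and indep: "\<And>N (n :: nat \<Rightarrow> nat \<Rightarrow> int) i j.
      \<lbrakk>(\<Sum>i\<le>N. \<Sum>j\<le>N. of_int (n i j) * a ^ i * b ^ j) = 0; i \<le> N; j \<le> N\<rbrakk> \<Longrightarrow> n i j = 0"
  shows "laurent_independent a b"
  unfolding laurent_independent_def
proof (intro allI impI ballI)
  fix S :: "(int \<times> int) set" and n u
  assume S: "finite S" and rel: "(\<Sum>(i, j)\<in>S. of_int (n (i, j)) * a powi i * b powi j) = 0" and u: "u \<in> S"
  \<comment> \<open>\<open>M\<close> bounds all exponents in absolute value, so multiplication by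
    \<open>a ^ M * b ^ M\<close> moves them into the range from 0 to \<open>2 * M\<close>.\<close>
  define M where "M = (\<Sum>(i, j)\<in>S. nat \<bar>i\<bar> + nat \<bar>j\<bar>)"
  have M: "\<bar>i\<bar> \<le> int M \<and> \<bar>j\<bar> \<le> int M" if "(i, j) \<in> S" for i j
    using member_le_sum [OF that, of "\<lambda>(i, j). nat \<bar>i\<bar> + nat \<bar>j\<bar>"] S unfolding M_def [symmetric] by simp linarith
  define m where "m i j = (let v = (int i - int M, int j - int M) in if v \<in> S then n v else 0)" for i j
  define g where "g = (\<lambda>(i, j). (int i - int M, int j - int M))"
  have inj: "inj_on g ({..2 * M} \<times> {..2 * M})"
    by (auto simp: g_def inj_on_def)
  have sub: "S \<subseteq> g ` ({..2 * M} \<times> {..2 * M})"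
  proof
    fix v assume "v \<in> S"
    moreover obtain i j where v: "v = (i, j)" by force
    ultimately have "\<bar>i\<bar> \<le> int M" "\<bar>j\<bar> \<le> int M" using M by blast+
    then have "0 \<le> i + int M" "0 \<le> j + int M" "i + int M \<le> int (2 * M)" "j + int M \<le> int (2 * M)"
      by linarith+
    then have "v = g (nat (i + int M), nat (j + int M))" "nat (i + int M) \<le> 2 * M" "nat (j + int M) \<le> 2 * M"
      by (simp_all add: v g_def nat_le_iff)
    then show "v \<in> g ` ({..2 * M} \<times> {..2 * M})"
      by blast
  qed
  define T where "T = (\<lambda>(i, j). of_int (if (i, j) \<in> S then n (i, j) else 0) * a powi i * b powi j)"
  have T: "of_int (m i j) * a ^ i * b ^ j = a ^ M * b ^ M * T (g (i, j))" for i j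
    using assms(1,2) by (simp add: m_def g_def T_def Let_def power_int_diff)
  have "(\<Sum>i\<le>2 * M. \<Sum>j\<le>2 * M. of_int (m i j) * a ^ i * b ^ j)
      = (\<Sum>p\<in>{..2 * M} \<times> {..2 * M}. a ^ M * b ^ M * T (g p))"
    unfolding T sum.cartesian_product by (rule sum.cong) auto
  also have "\<dots> = a ^ M * b ^ M * (\<Sum>v\<in>g ` ({..2 * M} \<times> {..2 * M}). T v)"
    unfolding sum.reindex [OF inj] by (simp add: sum_distrib_left)
  also have "(\<Sum>v\<in>g ` ({..2 * M} \<times> {..2 * M}). T v) = (\<Sum>(i, j)\<in>S. of_int (n (i, j)) * a powi i * b powi j)"
    by (rule sum.mono_neutral_cong_right) (use sub in \<open>auto simp: T_def\<close>)
  finally have "(\<Sum>i\<le>2 * M. \<Sum>j\<le>2 * M. of_int (m i j) * a ^ i * b ^ j) = 0"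
    using rel by simp
  from indep [OF this] have m0: "m i j = 0" if "i \<le> 2 * M" "j \<le> 2 * M" for i j
    using that by blast
  obtain p where "p \<in> {..2 * M} \<times> {..2 * M}" "u = g p"
    using sub u by blast
  then show "n u = 0"
    using m0 [of "fst p" "snd p"] u by (auto simp: m_def g_def Let_def)
qed

lemma laurent_independent_unit_squares:
  assumes "alg_indep3 r (r * cmod (1 - w)) (r * cmod w)" "Im w \<noteq> 0" "r > 0"
  shows "laurent_independent (unit_square (1 - w)) (unit_square w)"
proof (rule laurent_independent_if)
  show "unit_square (1 - w) \<noteq> 0" "unit_square w \<noteq> 0"
    using assms(2) by (auto simp: unit_square_def)
next
  fix N n i j
  assume rel: "(\<Sum>i\<le>N. \<Sum>j\<le>N. of_int (n i j) * unit_square (1 - w) ^ i * unit_square w ^ j) = 0"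
    and "i \<le> N" "j \<le> N"
  then show "n i j = (0::int)"
    by (intro unit_square_relation_trivial [where N = N] unit_square_relation_specialize [OF assms rel])
qed

section \<open>Faithful affine representations of two-generator metabelian groups\<close>

text \<open>Independence is applied to the difference of this monomial and the constant 1, so
  \<open>n\<close> is -1 at the origin.\<close>

lemma laurent_independent_monomial:
  assumes "laurent_independent a b" "a powi i * b powi j = 1"
  shows "i = 0 \<and> j = 0"
proof (rule ccontr)
  assume nz: "\<not> (i = 0 \<and> j = 0)"
  define n :: "int \<times> int \<Rightarrow> int" where "n u = (if u = (0, 0) then -1 else 1)" for u
  have "(\<Sum>(i, j)\<in>{(i, j), (0, 0)}. of_int (n (i, j)) * a powi i * b powi j) = 0"
    using nz assms(2) by (simp add: n_def)
  then have "\<forall>u\<in>{(i, j), (0, 0)}. n u = 0"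
    by (intro assms(1) [unfolded laurent_independent_def, rule_format] ballI) auto
  then show False
    by (simp add: n_def)
qed

lemma (in group) inv_mult_cancel:
  assumes "g \<in> carrier G" "h \<in> carrier G"
  shows "inv g \<otimes> (g \<otimes> h) = h" "g \<otimes> (inv g \<otimes> h) = h"
  using assms by (simp_all flip: m_assoc)

lemma (in group) comm_group_if_generators_commute:
  assumes gen: "carrier G = generate G A" and "A \<subseteq> carrier G"
    and comm: "\<And>x y. \<lbrakk>x \<in> A; y \<in> A\<rbrakk> \<Longrightarrow> x \<otimes> y = y \<otimes> x"
  shows "comm_group G"
proof (rule group_comm_groupI)
  have centralizer: "g \<otimes> h = h \<otimes> g" if "g \<in> carrier G" and h: "h \<in> carrier G"
    and A: "\<And>x. x \<in> A \<Longrightarrow> x \<otimes> h = h \<otimes> x" for g h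
    using that(1) unfolding gen
  proof (induction rule: generate.induct)
    case (inv x)
    then have "x \<in> carrier G" using assms(2) by blast
    then have "inv x \<otimes> h = inv x \<otimes> (h \<otimes> x) \<otimes> inv x"
      using h by (simp add: m_assoc)
    also have "\<dots> = h \<otimes> inv x"
      using A [OF inv] h \<open>x \<in> carrier G\<close> by (simp flip: A [OF inv] add: m_assoc [symmetric])
    finally show ?case .
  next
    case (eng x y)
    then have "x \<in> carrier G" "y \<in> carrier G" using gen by auto
    then show ?case
      using eng h by (metis m_assoc)
  qed (use A h in auto)
  fix x y assume xy: "x \<in> carrier G" "y \<in> carrier G"
  show "x \<otimes> y = y \<otimes> x"
  proof (rule centralizer [OF xy])
    fix z assume z: "z \<in> A"
    have "y \<otimes> z = z \<otimes> y"
      by (rule centralizer) (use xy z assms(2) comm in auto)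
    then show "z \<otimes> y = y \<otimes> z" ..
  qed
qed

text \<open>The element \<open>g\<close> acts by multiplication with \<open>\<alpha> g\<close>
  followed by translation by \<open>\<beta> g\<close>, products being composed left to right;
  \<open>x\<close> fixes 1 and \<open>y\<close> fixes 0. The locale is meant for \<open>F2\<close>
  modulo its second derived subgroup, where faithfulness of the action identifies a kernel.\<close>

locale affine_metabelian = group G for G :: "('a, 'm) monoid_scheme" (structure) +
  fixes x y :: 'a and \<alpha> \<beta> :: "'a \<Rightarrow> complex" and a b :: complex
  assumes x: "x \<in> carrier G" and y: "y \<in> carrier G"
    and gen: "carrier G = generate G {x, y}"
    and metabelian: "\<And>d d'. \<lbrakk>d \<in> derived G (carrier G); d' \<in> derived G (carrier G)\<rbrakk> \<Longrightarrow> d \<otimes> d' = d' \<otimes> d"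
    and \<alpha>_mult: "\<And>g h. \<lbrakk>g \<in> carrier G; h \<in> carrier G\<rbrakk> \<Longrightarrow> \<alpha> (g \<otimes> h) = \<alpha> g * \<alpha> h"
    and \<beta>_mult: "\<And>g h. \<lbrakk>g \<in> carrier G; h \<in> carrier G\<rbrakk> \<Longrightarrow> \<beta> (g \<otimes> h) = \<beta> h + \<alpha> h * \<beta> g"
    and \<alpha>_gen: "\<alpha> x = a" "\<alpha> y = b" and \<beta>_gen: "\<beta> x = 1 - a" "\<beta> y = 0"
    and nz: "a \<noteq> 0" "b \<noteq> 0" and indep: "laurent_independent a b"
begin

section \<open>The derived subgroup as a module over the abelianisation\<close>

definition D where "D = derived G (carrier G)"

definition basic :: "int \<times> int \<Rightarrow> 'a" where
  "basic = (\<lambda>(i, j). inv (x [^] i \<otimes> y [^] j) \<otimes> (x \<otimes> y \<otimes> inv x \<otimes> inv y) \<otimes> (x [^] i \<otimes> y [^] j))"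

lemma D_normal: "D \<lhd> G"
  unfolding D_def by (rule derived_self_is_normal)

lemma D_subgroup: "subgroup D G"
  using D_normal by (rule normal_imp_subgroup)

lemma D_carrier: "d \<in> D \<Longrightarrow> d \<in> carrier G"
  using D_subgroup by (rule subgroup.mem_carrier)

lemma commutator_in_D: "\<lbrakk>g \<in> carrier G; h \<in> carrier G\<rbrakk> \<Longrightarrow> g \<otimes> h \<otimes> inv g \<otimes> inv h \<in> D"
  unfolding D_def derived_def by (intro generate.incl) blast

lemma comm_group_D: "comm_group (G\<lparr>carrier := D\<rparr>)"
proof (rule group.group_comm_groupI [OF subgroup.subgroup_is_group [OF D_subgroup]])
  show "group G" ..
qed (use metabelian in \<open>auto simp: D_def\<close>)

lemma \<alpha>_one: "\<alpha> \<one> = 1"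
  using \<alpha>_mult [OF x one_closed] x nz by (simp add: \<alpha>_gen)

lemma \<beta>_one: "\<beta> \<one> = 0"
  using \<beta>_mult [OF one_closed one_closed] by (simp add: \<alpha>_one)

lemma \<alpha>_inv: "g \<in> carrier G \<Longrightarrow> \<alpha> (inv g) * \<alpha> g = 1"
  using \<alpha>_mult [of "inv g" g] by (simp add: \<alpha>_one)

lemma \<alpha>_nz: "g \<in> carrier G \<Longrightarrow> \<alpha> g \<noteq> 0"
  using \<alpha>_inv by force

lemma \<alpha>_inv': "g \<in> carrier G \<Longrightarrow> \<alpha> (inv g) = inverse (\<alpha> g)"
  using \<alpha>_inv \<alpha>_nz by (simp add: field_simps)

lemma \<beta>_inv: "g \<in> carrier G \<Longrightarrow> \<beta> (inv g) = - \<beta> g / \<alpha> g"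
  using \<beta>_mult [of "inv g" g] \<alpha>_nz by (simp add: \<beta>_one field_simps eq_neg_iff_add_eq_0)

lemma \<alpha>_pow: "g \<in> carrier G \<Longrightarrow> \<alpha> (g [^] (i::int)) = \<alpha> g powi i"
proof (induction i rule: int_induct [where k = 0])
  case base
  then show ?case by (simp add: \<alpha>_one)
next
  case (step1 i)
  then show ?case
    by (simp add: int_pow_mult \<alpha>_mult power_int_add \<alpha>_nz)
next
  case (step2 i)
  then show ?case
    by (simp add: int_pow_diff \<alpha>_mult \<alpha>_inv' power_int_diff \<alpha>_nz divide_inverse)
qed

lemma \<alpha>_D: "d \<in> D \<Longrightarrow> \<alpha> d = 1"
proof -
  have "subgroup {g \<in> carrier G. \<alpha> g = 1} G"
    by unfold_locales (auto simp: \<alpha>_mult \<alpha>_one \<alpha>_inv')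
  moreover have "derived_set G (carrier G) \<subseteq> {g \<in> carrier G. \<alpha> g = 1}"
    by (auto simp: \<alpha>_mult \<alpha>_inv' \<alpha>_nz field_simps)
  ultimately have "D \<subseteq> {g \<in> carrier G. \<alpha> g = 1}"
    unfolding D_def derived_def by (intro generate_subgroup_incl)
  then show "d \<in> D \<Longrightarrow> \<alpha> d = 1" by blast
qed

lemma \<beta>_conj: "\<lbrakk>g \<in> carrier G; d \<in> D\<rbrakk> \<Longrightarrow> \<beta> (inv g \<otimes> d \<otimes> g) = \<alpha> g * \<beta> d"
  using \<alpha>_nz [of g] D_carrier [of d] by (simp add: \<beta>_mult \<beta>_inv \<alpha>_D field_simps)

lemma conj_D: "\<lbrakk>g \<in> carrier G; d \<in> D\<rbrakk> \<Longrightarrow> inv g \<otimes> d \<otimes> g \<in> D"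
  using normal.inv_op_closed1 [OF D_normal] by blast

lemma basic_D: "basic u \<in> D"
  using x y by (auto simp: basic_def split: prod.split intro!: conj_D commutator_in_D)

lemma basic_carrier: "basic u \<in> carrier G"
  by (rule D_carrier [OF basic_D])

text \<open>The last factor is the translation of the commutator of \<open>x\<close> and
  \<open>y\<close>; conjugation multiplies it by the multiplier of the conjugating element. It is
  nonzero by \<open>ab_nontrivial\<close>.\<close>

lemma \<beta>_basic: "\<beta> (basic (i, j)) = a powi i * b powi j * ((b - 1) * (1 - a) / (a * b))"
proof -
  have "\<beta> (x \<otimes> y \<otimes> inv x \<otimes> inv y) = (b - 1) * (1 - a) / (a * b)"
    using x y nz by (simp add: \<beta>_mult \<beta>_inv \<alpha>_mult \<alpha>_inv' \<alpha>_gen \<beta>_gen field_simps)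
  then show ?thesis
    using x y by (simp add: basic_def \<beta>_conj commutator_in_D \<alpha>_mult \<alpha>_pow \<alpha>_gen)
qed

lemma ab_nontrivial: "a \<noteq> 1" "b \<noteq> 1"
  using laurent_independent_monomial [OF indep, of 1 0] laurent_independent_monomial [OF indep, of 0 1]
  by auto

text \<open>Because \<open>D\<close> is abelian, conjugation on \<open>D\<close> depends only on the
  class of the conjugating element modulo \<open>D\<close>.\<close>

lemma conj_cong:
  assumes g: "g \<in> carrier G" and h: "h \<in> carrier G" and d: "d \<in> D" and "inv h \<otimes> g \<in> D"
  shows "inv g \<otimes> d \<otimes> g = inv h \<otimes> d \<otimes> h"
proof -
  define e where "e = inv h \<otimes> g"
  define d' where "d' = inv h \<otimes> d \<otimes> h"
  have e: "e \<in> D" "e \<in> carrier G" and d': "d' \<in> D" "d' \<in> carrier G"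
    using assms D_carrier conj_D by (auto simp: e_def d'_def)
  have "g = h \<otimes> e"
    using g h by (simp add: e_def flip: m_assoc)
  then have "inv g \<otimes> d \<otimes> g = inv e \<otimes> d' \<otimes> e"
    using h e D_carrier [OF d] by (simp add: d'_def inv_mult_group m_assoc)
  also have "\<dots> = inv e \<otimes> (e \<otimes> d')"
    using metabelian [of d' e] e d' by (simp add: D_def m_assoc)
  also have "\<dots> = d'"
    using e d' by (simp flip: m_assoc)
  finally show ?thesis by (simp add: d'_def)
qed

lemma conj_conj:
  "\<lbrakk>g \<in> carrier G; h \<in> carrier G; d \<in> carrier G\<rbrakk> \<Longrightarrow>
     inv (g \<otimes> h) \<otimes> d \<otimes> (g \<otimes> h) = inv h \<otimes> (inv g \<otimes> d \<otimes> g) \<otimes> h"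
  by (simp add: inv_mult_group m_assoc)

lemma conj_basic_y: "inv (y [^] k) \<otimes> basic (i, j) \<otimes> y [^] (k::int) = basic (i, j + k)"
proof -
  have "x [^] i \<otimes> y [^] j \<otimes> y [^] k = x [^] i \<otimes> y [^] (j + k)"
    using x y by (simp add: int_pow_mult m_assoc)
  then show ?thesis
    using x y conj_conj [of "x [^] i \<otimes> y [^] j" "y [^] k" "x \<otimes> y \<otimes> inv x \<otimes> inv y"]
    by (simp add: basic_def)
qed

text \<open>Here \<open>x [^] k\<close> has to pass \<open>y [^] j\<close>. The price is a
  commutator, which lies in \<open>D\<close> and therefore acts trivially.\<close>

lemma conj_basic_x: "inv (x [^] k) \<otimes> basic (i, j) \<otimes> x [^] (k::int) = basic (i + k, j)"
proof -
  define c where "c = x \<otimes> y \<otimes> inv x \<otimes> inv y"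
  define g where "g = x [^] i \<otimes> y [^] j \<otimes> x [^] k"
  define h where "h = x [^] (i + k) \<otimes> y [^] j"
  have c: "c \<in> D" "c \<in> carrier G" and gh: "g \<in> carrier G" "h \<in> carrier G"
    using x y by (auto simp: c_def g_def h_def commutator_in_D)
  have "x [^] (i + k) = x [^] i \<otimes> x [^] k"
    using x by (simp add: int_pow_mult)
  then have "inv h \<otimes> g = inv (y [^] j) \<otimes> inv (x [^] k) \<otimes> inv (inv (y [^] j)) \<otimes> inv (inv (x [^] k))"
    using x y by (simp add: g_def h_def inv_mult_group m_assoc inv_mult_cancel)
  then have "inv h \<otimes> g \<in> D"
    using x y commutator_in_D [of "inv (y [^] j)" "inv (x [^] k)"] by simp
  then have "inv g \<otimes> c \<otimes> g = inv h \<otimes> c \<otimes> h"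
    by (rule conj_cong [OF gh c(1)])
  moreover have "inv (x [^] k) \<otimes> basic (i, j) \<otimes> x [^] k = inv g \<otimes> c \<otimes> g"
    using x y c unfolding g_def by (subst conj_conj) (auto simp: basic_def c_def)
  ultimately show ?thesis
    by (simp add: h_def c_def basic_def)
qed

lemma conj_basic: "g \<in> carrier G \<Longrightarrow> \<exists>v. inv g \<otimes> basic u \<otimes> g = basic v"
  unfolding gen
proof (induction arbitrary: u rule: generate.induct)
  case one
  show ?case using basic_carrier by (intro exI [of _ u]) simp
next
  case (incl g)
  then show ?case
    using conj_basic_x [of 1 "fst u" "snd u"] conj_basic_y [of 1 "fst u" "snd u"] x y
    by auto
next
  case (inv g)
  then show ?case
    using conj_basic_x [of "-1" "fst u" "snd u"] conj_basic_y [of "-1" "fst u" "snd u"] x y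
    by (auto simp: int_pow_neg simp del: split_paired_Ex)
next
  case (eng g h)
  then have "g \<in> carrier G" "h \<in> carrier G" using gen by auto
  then show ?case
    using eng.IH basic_carrier by (metis conj_conj)
qed

lemma basic_normal: "generate G (range basic) \<lhd> G"
proof (rule normal_generateI)
  fix h g assume "h \<in> range basic" and g: "g \<in> carrier G"
  then obtain u where "h = basic u" by blast
  then show "g \<otimes> h \<otimes> inv g \<in> range basic"
    using conj_basic [of "inv g" u] g by (metis inv_closed inv_inv rangeI)
qed (use basic_carrier in auto)

text \<open>Modulo the normal subgroup generated by the \<open>basic\<close> elements,
  \<open>x\<close> and \<open>y\<close> commute. The quotient is abelian, so that subgroup contains
  the derived one.\<close>

lemma D_generated: "D \<subseteq> generate G (range basic)"
proof -
  define P where "P = generate G (range basic)"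
  interpret P: normal P G unfolding P_def by (rule basic_normal)
  interpret Q: group "G Mod P" by (rule P.factorgroup_is_group)
  interpret q: group_hom G "G Mod P" "\<lambda>g. P #> g"
    by unfold_locales (rule P.r_coset_hom_Mod)
  have c: "P #> (x \<otimes> y \<otimes> inv x \<otimes> inv y) = \<one>\<^bsub>G Mod P\<^esub>"
  proof -
    have "basic (0, 0) \<in> P"
      unfolding P_def by (intro generate.incl) blast
    then have "x \<otimes> y \<otimes> inv x \<otimes> inv y \<in> P"
      using x y by (simp add: basic_def)
    then show ?thesis
      using P.rcos_const by simp
  qed
  have "x \<otimes> y = (x \<otimes> y \<otimes> inv x \<otimes> inv y) \<otimes> (y \<otimes> x)"
    using x y by (simp add: m_assoc inv_mult_cancel)
  then have "P #> (x \<otimes> y) = (P #> (x \<otimes> y \<otimes> inv x \<otimes> inv y)) \<otimes>\<^bsub>G Mod P\<^esub> (P #> (y \<otimes> x))"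
    using x y by (metis q.hom_mult inv_closed m_closed)
  then have comm: "(P #> x) \<otimes>\<^bsub>G Mod P\<^esub> (P #> y) = (P #> y) \<otimes>\<^bsub>G Mod P\<^esub> (P #> x)"
    unfolding c using x y by (metis q.hom_mult m_closed q.hom_closed Q.l_one)
  have "comm_group (G Mod P)"
  proof (rule Q.comm_group_if_generators_commute)
    show "carrier (G Mod P) = generate (G Mod P) {P #> x, P #> y}"
      using q.generate_img [of "{x, y}"] x y gen by (simp add: carrier_FactGroup)
    show "{P #> x, P #> y} \<subseteq> carrier (G Mod P)"
      using x y q.hom_closed by blast
  qed (use comm in auto)
  then show ?thesis
    unfolding D_def P_def [symmetric] using derived_minimal P.normal_axioms by blast
qed

text \<open>As \<open>n\<close> vanishes outside \<open>S\<close>, two such products can be extended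
  to the union of their index sets and multiplied termwise.\<close>

lemma generate_basic_finprod:
  assumes "d \<in> generate G (range basic)"
  shows "\<exists>S n. finite S \<and> (\<forall>u. u \<notin> S \<longrightarrow> n u = (0::int)) \<and>
     d = finprod (G\<lparr>carrier := D\<rparr>) (\<lambda>u. basic u [^] n u) S"
proof -
  interpret D: comm_group "G\<lparr>carrier := D\<rparr>" by (rule comm_group_D)
  have pow_D: "basic u [^] (k::int) \<in> D" for u k
    by (rule subgroup_int_pow_closed [OF D_subgroup basic_D])
  have single: "\<exists>S n. finite S \<and> (\<forall>u. u \<notin> S \<longrightarrow> n u = (0::int)) \<and>
      basic v [^] k = finprod (G\<lparr>carrier := D\<rparr>) (\<lambda>u. basic u [^] n u) S" for v and k :: int
    by (intro exI [of _ "{v}"] exI [of _ "\<lambda>u. if u = v then k else 0"])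
       (simp add: pow_D basic_carrier)
  show ?thesis
    using assms
  proof (induction rule: generate.induct)
    case one
    show ?case
      by (intro exI [of _ "{}"] exI [of _ "\<lambda>u. 0"]) simp
  next
    case (incl h)
    then obtain v where "h = basic v" by blast
    then show ?case using single [of v 1] basic_carrier by simp
  next
    case (inv h)
    then obtain v where "h = basic v" by blast
    then show ?case using single [of v "-1"] basic_carrier by (simp add: int_pow_neg)
  next
    case (eng d d')
    then obtain S n S' n' where S: "finite S" "\<forall>u. u \<notin> S \<longrightarrow> n u = (0::int)"
        "finite S'" "\<forall>u. u \<notin> S' \<longrightarrow> n' u = (0::int)"
      and d: "d = finprod (G\<lparr>carrier := D\<rparr>) (\<lambda>u. basic u [^] n u) S"
      and d': "d' = finprod (G\<lparr>carrier := D\<rparr>) (\<lambda>u. basic u [^] n' u) S'" by blast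
    have "d = finprod (G\<lparr>carrier := D\<rparr>) (\<lambda>u. basic u [^] n u) (S \<union> S')"
      unfolding d using S by (intro D.finprod_mono_neutral_cong_left) (auto simp: pow_D)
    moreover have "d' = finprod (G\<lparr>carrier := D\<rparr>) (\<lambda>u. basic u [^] n' u) (S \<union> S')"
      unfolding d' using S by (intro D.finprod_mono_neutral_cong_left) (auto simp: pow_D)
    moreover have "basic u [^] (n u + n' u) = basic u [^] n u \<otimes>\<^bsub>G\<lparr>carrier := D\<rparr>\<^esub> basic u [^] n' u" for u
      by (simp add: int_pow_mult basic_carrier)
    ultimately have "d \<otimes> d' = finprod (G\<lparr>carrier := D\<rparr>) (\<lambda>u. basic u [^] (n u + n' u)) (S \<union> S')"
      using D.finprod_multf [of "\<lambda>u. basic u [^] n u" "S \<union> S'" "\<lambda>u. basic u [^] n' u"]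
      by (simp add: pow_D Pi_iff)
    then show ?case
      using S by (intro exI [of _ "S \<union> S'"] exI [of _ "\<lambda>u. n u + n' u"]) auto
  qed
qed

lemma \<beta>_pow_D: "d \<in> D \<Longrightarrow> \<beta> (d [^] (k::int)) = of_int k * \<beta> d"
proof (induction k rule: int_induct [where k = 0])
  case base
  then show ?case by (simp add: \<beta>_one)
next
  case (step1 i)
  then show ?case
    by (simp add: int_pow_mult \<beta>_mult \<alpha>_D \<alpha>_pow D_carrier algebra_simps)
next
  case (step2 i)
  then show ?case
    by (simp add: \<alpha>_pow int_pow_diff \<beta>_mult \<beta>_inv \<alpha>_inv' \<alpha>_D D_carrier algebra_simps)
qed

lemma \<beta>_finprod:
  assumes "finite S" "f \<in> S \<rightarrow> D"
  shows "\<beta> (finprod (G\<lparr>carrier := D\<rparr>) f S) = (\<Sum>u\<in>S. \<beta> (f u))"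
proof -
  interpret D: comm_group "G\<lparr>carrier := D\<rparr>" by (rule comm_group_D)
  show ?thesis
    using assms
  proof (induction S rule: finite_induct)
    case empty
    then show ?case by (simp add: \<beta>_one)
  next
    case (insert u S)
    have "finprod (G\<lparr>carrier := D\<rparr>) f S \<in> carrier (G\<lparr>carrier := D\<rparr>)"
      using insert by (intro D.finprod_closed) auto
    then have mem: "finprod (G\<lparr>carrier := D\<rparr>) f S \<in> D" by simp
    have "finprod (G\<lparr>carrier := D\<rparr>) f (Set.insert u S) = f u \<otimes> finprod (G\<lparr>carrier := D\<rparr>) f S"
      using insert D.finprod_insert [of S u f] by auto
    then show ?case
      using insert mem D_carrier \<alpha>_D [OF mem] by (simp add: \<beta>_mult Pi_iff)
  qed
qed

lemma \<beta>_inj_D: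
  assumes "d \<in> D" "\<beta> d = 0"
  shows "d = \<one>"
proof -
  interpret D: comm_group "G\<lparr>carrier := D\<rparr>" by (rule comm_group_D)
  obtain S n where S: "finite S"
    and d: "d = finprod (G\<lparr>carrier := D\<rparr>) (\<lambda>u. basic u [^] (n u :: int)) S"
    using generate_basic_finprod [OF subsetD [OF D_generated assms(1)]] by blast
  define \<kappa> where "\<kappa> = (b - 1) * (1 - a) / (a * b)"
  have "0 = (\<Sum>u\<in>S. \<beta> (basic u [^] n u))"
    using \<beta>_finprod [OF S, of "\<lambda>u. basic u [^] n u"] assms(2) d
      subgroup_int_pow_closed [OF D_subgroup basic_D] by simp
  also have "\<dots> = (\<Sum>(i, j)\<in>S. of_int (n (i, j)) * a powi i * b powi j) * \<kappa>"
    unfolding sum_distrib_right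
    by (rule sum.cong) (auto simp: \<beta>_pow_D basic_D \<beta>_basic \<kappa>_def)
  finally have "(\<Sum>(i, j)\<in>S. of_int (n (i, j)) * a powi i * b powi j) = 0"
    using ab_nontrivial nz by (simp add: \<kappa>_def)
  then have "\<forall>u\<in>S. n u = 0"
    using indep S unfolding laurent_independent_def by blast
  then have "finprod (G\<lparr>carrier := D\<rparr>) (\<lambda>u. basic u [^] n u) S = \<one>\<^bsub>G\<lparr>carrier := D\<rparr>\<^esub>"
    by (intro D.finprod_one_eqI) simp
  then show ?thesis
    by (simp add: d)
qed

lemma mod_D_monomial:
  assumes "g \<in> carrier G"
  shows "\<exists>i j. D #> g = D #> (x [^] (i::int) \<otimes> y [^] (j::int))"
proof -
  interpret DN: normal D G by (rule D_normal)
  interpret Q: comm_group "G Mod D" unfolding D_def by (rule derived_quot_is_comm_group)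
  interpret q: group_hom G "G Mod D" "\<lambda>g. D #> g"
    by unfold_locales (rule DN.r_coset_hom_Mod)
  have mon: "D #> (x [^] i \<otimes> y [^] j) = (D #> x) [^]\<^bsub>G Mod D\<^esub> i \<otimes>\<^bsub>G Mod D\<^esub> (D #> y) [^]\<^bsub>G Mod D\<^esub> j"
    for i j :: int
    using x y by (metis q.hom_mult q.hom_int_pow int_pow_closed)
  have xy: "D #> x \<in> carrier (G Mod D)" "D #> y \<in> carrier (G Mod D)"
    using x y q.hom_closed by blast+
  show ?thesis
    using assms unfolding gen mon
  proof (induction rule: generate.induct)
    case one
    have "D #> \<one> = \<one>\<^bsub>G Mod D\<^esub>" by (rule q.hom_one)
    then show ?case
      by (intro exI [of _ 0]) (simp del: one_FactGroup mult_FactGroup)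
  next
    case (incl g)
    show ?case
    proof (cases "g = x")
      case True
      then show ?thesis
        using xy by (intro exI [of _ 1] exI [of _ 0]) (simp del: one_FactGroup mult_FactGroup)
    next
      case False
      then show ?thesis
        using xy incl by (intro exI [of _ 0] exI [of _ 1]) (simp del: one_FactGroup mult_FactGroup)
    qed
  next
    case (inv g)
    have inv': "D #> inv z = inv\<^bsub>G Mod D\<^esub> (D #> z)" if "z \<in> carrier G" for z
      using that by (rule q.hom_inv)
    show ?case
    proof (cases "g = x")
      case True
      then show ?thesis
        using xy x inv' [of x] by (intro exI [of _ "-1"] exI [of _ 0]) (simp add: Q.int_pow_neg del: one_FactGroup mult_FactGroup)
    next
      case False
      then show ?thesis
        using xy y inv' [of y] \<open>g \<in> {x, y}\<close> by (intro exI [of _ 0] exI [of _ "-1"]) (simp add: Q.int_pow_neg del: one_FactGroup mult_FactGroup)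
    qed
  next
    case (eng g h)
    then obtain i j k l :: int where g: "D #> g = (D #> x) [^]\<^bsub>G Mod D\<^esub> i \<otimes>\<^bsub>G Mod D\<^esub> (D #> y) [^]\<^bsub>G Mod D\<^esub> j"
      and h: "D #> h = (D #> x) [^]\<^bsub>G Mod D\<^esub> k \<otimes>\<^bsub>G Mod D\<^esub> (D #> y) [^]\<^bsub>G Mod D\<^esub> l" by blast
    have "D #> (g \<otimes> h) = (D #> g) \<otimes>\<^bsub>G Mod D\<^esub> (D #> h)"
      using eng gen q.hom_mult by blast
    also have "\<dots> = (D #> x) [^]\<^bsub>G Mod D\<^esub> (i + k) \<otimes>\<^bsub>G Mod D\<^esub> (D #> y) [^]\<^bsub>G Mod D\<^esub> (j + l)"
      unfolding g h using xy by (simp add: Q.int_pow_mult Q.m_ac del: one_FactGroup mult_FactGroup)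
    finally show ?case by blast
  qed
qed

text \<open>The multiplier determines the class modulo \<open>D\<close>, because
  \<open>a powi i * b powi j\<close> is 1 only for \<open>i = j = 0\<close>. What remains lies in
  \<open>D\<close>, where \<open>\<beta>\<close> is injective.\<close>

theorem affine_faithful:
  assumes g: "g \<in> carrier G" and "\<alpha> g = 1" "\<beta> g = 0"
  shows "g = \<one>"
proof -
  interpret DN: normal D G by (rule D_normal)
  obtain i j :: int where ij: "D #> g = D #> (x [^] i \<otimes> y [^] j)"
    using mod_D_monomial [OF g] by blast
  define h where "h = x [^] i \<otimes> y [^] j"
  have h: "h \<in> carrier G" using x y by (simp add: h_def)
  have "g \<in> D #> h"
    using ij rcos_self [OF g D_subgroup] by (simp add: h_def)
  then obtain d where d: "d \<in> D" "g = d \<otimes> h"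
    unfolding r_coset_def by blast
  then have "\<alpha> h = 1"
    using assms(2) h D_carrier [of d] \<alpha>_D [of d] by (simp add: \<alpha>_mult)
  then have "i = 0 \<and> j = 0"
    using x y by (intro laurent_independent_monomial [OF indep]) (simp add: h_def \<alpha>_mult \<alpha>_pow \<alpha>_gen)
  then have "g \<in> D"
    using d D_carrier by (simp add: h_def)
  then show ?thesis
    using \<beta>_inj_D assms(3) by blast
qed

end

section \<open>Class-two approximations of the triangle group\<close>

type_synonym point = "int \<times> int"

text \<open>A list \<open>f\<close> of pairs \<open>(c, u)\<close> stands for the Laurent polynomial \<open>\<Sum> c X\<^sup>u\<close> in two variables;
  \<open>laurent_coeff f\<close> is its coefficient function.\<close>

definition pairing :: "(int \<times> point) list \<Rightarrow> (point \<Rightarrow> 'r::ring_1) \<Rightarrow> 'r" where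
  "pairing f \<phi> = (\<Sum>(c, u)\<leftarrow>f. of_int c * \<phi> u)"

definition laurent_coeff :: "(int \<times> point) list \<Rightarrow> point \<Rightarrow> int" where
  "laurent_coeff f v = pairing f (\<lambda>u. if u = v then 1 else 0)"

text \<open>An antisymmetric form on Laurent polynomials that pairs a monomial with its multiples by
  \<open>X\<close> to the powers m and -m, with opposite signs. Only the first argument has to be a
  finite list; the second may be any coefficient function.\<close>

definition skew :: "int \<Rightarrow> (int \<times> point) list \<Rightarrow> (point \<Rightarrow> int) \<Rightarrow> int" where
  "skew m f h = pairing f (\<lambda>u. h (u + (m, 0)) - h (u - (m, 0)))"

text \<open>Inverting the variables and multiplying by the monomial with exponent
  \<open>\<tau>\<close>, which is the linear part of a reflection; \<open>shift\<close> is the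
  corresponding linear part of a rotation.\<close>

definition flip :: "point \<Rightarrow> (int \<times> point) list \<Rightarrow> (int \<times> point) list" where
  "flip \<tau> f = map (\<lambda>(c, u). (c, \<tau> - u)) f"

definition shift :: "point \<Rightarrow> (int \<times> point) list \<Rightarrow> (int \<times> point) list" where
  "shift \<tau> f = map (\<lambda>(c, u). (c, \<tau> + u)) f"

lemma pairing_simps [simp]:
  "pairing [] \<phi> = 0"
  "pairing ((c, u) # f) \<phi> = of_int c * \<phi> u + pairing f \<phi>"
  "pairing (f @ g) \<phi> = pairing f \<phi> + pairing g \<phi>"
  by (simp_all add: pairing_def)

lemma pairing_flip: "pairing (flip \<tau> f) \<phi> = pairing f (\<lambda>u. \<phi> (\<tau> - u))"
  by (induction f) (auto simp: flip_def)

lemma pairing_shift: "pairing (shift \<tau> f) \<phi> = pairing f (\<lambda>u. \<phi> (\<tau> + u))"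
  by (induction f) (auto simp: shift_def)

lemma laurent_coeff_flip: "laurent_coeff (flip \<tau> f) v = laurent_coeff f (\<tau> - v)"
proof -
  have "(\<tau> - u = v) = (u = \<tau> - v)" for u by (auto simp: algebra_simps)
  then show ?thesis by (simp add: laurent_coeff_def pairing_flip)
qed

lemma laurent_coeff_shift: "laurent_coeff (shift \<tau> f) v = laurent_coeff f (v - \<tau>)"
proof -
  have "(\<tau> + u = v) = (u = v - \<tau>)" for u by (auto simp: algebra_simps)
  then show ?thesis by (simp add: laurent_coeff_def pairing_shift)
qed

lemma laurent_coeff_append: "laurent_coeff (f @ g) v = laurent_coeff f v + laurent_coeff g v"
  by (simp add: laurent_coeff_def)

lemma laurent_coeff_eq_0: "v \<notin> snd ` set f \<Longrightarrow> laurent_coeff f v = 0"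
  unfolding laurent_coeff_def by (induction f) auto

lemma skew_append: "skew m (f @ g) h = skew m f h + skew m g h"
  by (simp add: skew_def)

lemma skew_add: "skew m f (\<lambda>v. h v + h' v) = skew m f h + skew m f h'"
  unfolding skew_def by (induction f) (auto simp: algebra_simps)

lemma skew_zero: "skew m f (\<lambda>v. 0) = 0"
  unfolding skew_def by (induction f) auto

text \<open>Negating exponents exchanges the two terms of the form. This sign is what forces
  reflections to act on the centre by inversion.\<close>

lemma skew_flip: "skew m (flip \<tau> f) (\<lambda>v. h (\<tau> - v)) = - skew m f h"
  unfolding skew_def by (induction f) (auto simp: flip_def algebra_simps)

lemma skew_shift: "skew m (shift \<tau> f) h = skew m f (\<lambda>v. h (v + \<tau>))"
  unfolding skew_def by (induction f) (auto simp: shift_def algebra_simps)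

lemma pairing_collect:
  assumes "finite S" "snd ` set f \<subseteq> S"
  shows "pairing f \<phi> = (\<Sum>u\<in>S. of_int (laurent_coeff f u) * \<phi> u)"
  using assms(2)
proof (induction f)
  case (Cons x f)
  obtain c v where x: "x = (c, v)" by (cases x)
  have "(\<Sum>u\<in>S. of_int (c * (if v = u then 1 else 0)) * \<phi> u) = (\<Sum>u\<in>S. if v = u then of_int c * \<phi> u else 0)"
    by (rule sum.cong) auto
  also have "\<dots> = of_int c * \<phi> v"
    using Cons.prems assms(1) x by simp
  finally have "(\<Sum>u\<in>S. of_int (laurent_coeff (x # f) u) * \<phi> u) = of_int c * \<phi> v + (\<Sum>u\<in>S. of_int (laurent_coeff f u) * \<phi> u)"
    unfolding x laurent_coeff_def pairing_simps of_int_add distrib_right sum.distrib by simp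
  then show ?case
    using Cons by (simp add: x)
qed (simp add: laurent_coeff_def)

text \<open>The list need not be empty, but its collected coefficients vanish. In particular
  \<open>laurent_coeff\<close> and \<open>skew\<close> vanish on it.\<close>

lemma laurent_independent_pairing:
  assumes "laurent_independent a b" "pairing f (\<lambda>(i, j). a powi i * b powi j) = 0"
  shows "pairing f \<phi> = (0 :: int)"
proof -
  define S where "S = snd ` set f"
  have S: "finite S" "snd ` set f \<subseteq> S" by (auto simp: S_def)
  have "(\<Sum>(i, j)\<in>S. of_int (laurent_coeff f (i, j)) * a powi i * b powi j)
      = pairing f (\<lambda>(i, j). a powi i * b powi j)"
    unfolding pairing_collect [OF S] by (rule sum.cong) (auto simp: mult.assoc)
  then have "\<forall>u\<in>S. laurent_coeff f u = 0"
    using assms S(1) by (intro assms(1) [unfolded laurent_independent_def, rule_format] ballI) auto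
  then show ?thesis
    unfolding pairing_collect [OF S] by simp
qed

text \<open>A state \<open>(f, q, e)\<close> encodes the map sending \<open>z\<close> to \<open>f + X\<^sup>q z\<close> if \<open>e\<close> holds and to \<open>f + X\<^sup>q z'\<close>
  otherwise, where the prime is the involution inverting the variables.  Generator 1 is the
  involution itself, generators 2 and 3 compose it with \<open>z \<mapsto> 1 - X + X z\<close> and \<open>z \<mapsto> Y z\<close>.\<close>

type_synonym state = "(int \<times> point) list \<times> point \<times> bool"

definition refl_vec :: "nat \<Rightarrow> point" where
  "refl_vec i = (if i = 1 then (0, 0) else if i = 2 then (1, 0) else (0, 1))"

definition refl_poly :: "nat \<Rightarrow> (int \<times> point) list" where
  "refl_poly i = (if i = 2 then [(1, (0, 0)), (-1, (1, 0))] else [])"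

definition next_state :: "nat \<Rightarrow> state \<Rightarrow> state" where
  "next_state i = (\<lambda>(f, q, e). (refl_poly i @ flip (refl_vec i) f, refl_vec i - q, \<not> e))"

text \<open>The signs of the letters are dropped because all three generators are
  involutions.\<close>

definition word_state :: "(nat \<times> bool) list \<Rightarrow> state \<Rightarrow> state" where
  "word_state w = fold (\<lambda>(i, s). next_state i) w"

lemma word_state_simps [simp]:
  "word_state [] st = st"
  "word_state ((i, s) # w) st = word_state w (next_state i st)"
  by (simp_all add: word_state_def)

definition complex_act :: "complex \<Rightarrow> complex \<Rightarrow> state \<Rightarrow> complex \<Rightarrow> complex" where
  "complex_act a b = (\<lambda>(f, q, e) z. pairing f (\<lambda>(i, j). a powi i * b powi j) +
     a powi fst q * b powi snd q * (if e then z else cnj z))"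

text \<open>The Heisenberg extension of the additive group of Laurent polynomials by \<open>\<int>\<close> whose cocycle
  \<open>skew m\<close> only sees pairs of monomials that differ by \<open>X\<^sup>m\<close>.\<close>

definition heis_act :: "int \<Rightarrow> state \<Rightarrow> int \<Rightarrow> (point \<Rightarrow> int) \<times> int \<Rightarrow> (point \<Rightarrow> int) \<times> int" where
  "heis_act m = (\<lambda>(f, q, e) \<zeta> (g, s). let h = (\<lambda>v. g (if e then v - q else q - v)) in
     (\<lambda>v. laurent_coeff f v + h v, (if e then s else - s) + skew m f h + \<zeta>))"

definition heis_refl :: "int \<Rightarrow> nat \<Rightarrow> (point \<Rightarrow> int) \<times> int \<Rightarrow> (point \<Rightarrow> int) \<times> int" where
  "heis_refl m i = heis_act m (refl_poly i, refl_vec i, False) 0"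

text \<open>Products run left to right as in \<open>E2_group\<close>, so a word acts in the same
  order in both groups.\<close>

definition perm_group :: "('x \<Rightarrow> 'x) monoid" where
  "perm_group = \<lparr>carrier = {f. bij f}, mult = (\<lambda>g h. h \<circ> g), one = id\<rparr>"

lemma perm_group_sel [simp]:
  "f \<in> carrier perm_group \<longleftrightarrow> bij f"
  "g \<otimes>\<^bsub>perm_group\<^esub> h = h \<circ> g"
  "\<one>\<^bsub>perm_group\<^esub> = id"
  by (simp_all add: perm_group_def)

section \<open>Lifts of the reflections and the survival of short relations\<close>

lemma group_perm_group: "group perm_group"
proof (rule groupI)
  fix f :: "'x \<Rightarrow> 'x"
  assume f: "f \<in> carrier perm_group"
  then have "Hilbert_Choice.inv f \<in> carrier perm_group" "Hilbert_Choice.inv f \<otimes>\<^bsub>perm_group\<^esub> f = \<one>\<^bsub>perm_group\<^esub>"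
    by (auto simp: bij_imp_bij_inv bij_is_surj simp flip: surj_iff)
  then show "\<exists>h\<in>carrier perm_group. h \<otimes>\<^bsub>perm_group\<^esub> f = \<one>\<^bsub>perm_group\<^esub>" by blast
qed (auto intro: bij_comp)

text \<open>Lifts compose like the affine maps up to the centre. The new central term is the form on
  the translation of the reflection and the flipped translation collected so far; the old one
  changes sign.\<close>

lemma heis_refl_act:
  "heis_refl m i (heis_act m (f, q, e) \<zeta> z) =
   heis_act m (next_state i (f, q, e)) (skew m (refl_poly i) (laurent_coeff (flip (refl_vec i) f)) - \<zeta>) z"
proof -
  obtain g s where z: "z = (g, s)" by force
  define \<tau> where "\<tau> = refl_vec i"
  define h where "h v = g (if e then v - q else q - v)" for v
  have h: "h (\<tau> - v) = g (if \<not> e then v - (\<tau> - q) else (\<tau> - q) - v)" for v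
    by (simp add: h_def algebra_simps)
  have "heis_refl m i (heis_act m (f, q, e) \<zeta> z) =
      (\<lambda>v. laurent_coeff (refl_poly i) v + (laurent_coeff f (\<tau> - v) + h (\<tau> - v)),
       - ((if e then s else - s) + skew m f h + \<zeta>)
         + skew m (refl_poly i) (\<lambda>v. laurent_coeff f (\<tau> - v) + h (\<tau> - v)))"
    by (simp add: heis_refl_def heis_act_def z h_def [abs_def] Let_def \<tau>_def)
  also have "\<dots> = (\<lambda>v. laurent_coeff (refl_poly i @ flip \<tau> f) v + h (\<tau> - v),
       (if \<not> e then s else - s) + skew m (refl_poly i @ flip \<tau> f) (\<lambda>v. h (\<tau> - v))
         + (skew m (refl_poly i) (laurent_coeff (flip \<tau> f)) - \<zeta>))"
    by (simp add: laurent_coeff_append laurent_coeff_flip [abs_def] skew_append skew_flip skew_add add.assoc)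
  also have "\<dots> = heis_act m (next_state i (f, q, e))
      (skew m (refl_poly i) (laurent_coeff (flip \<tau> f)) - \<zeta>) z"
    unfolding h unfolding \<tau>_def by (simp add: heis_act_def next_state_def z Let_def)
  finally show ?thesis by (simp add: \<tau>_def)
qed

lemma heis_act_trivial: "heis_act m ([], 0, True) 0 = id"
  by (auto simp: heis_act_def laurent_coeff_def skew_def fun_eq_iff Let_def)

text \<open>For generator 2 the translations \<open>1 - X\<close> and \<open>X - 1\<close> cancel,
  and the central term is an antisymmetric form on a polynomial and its negative, hence 0.\<close>

lemma heis_refl_involution: "heis_refl m i (heis_refl m i z) = z"
proof -
  have "heis_refl m i (heis_refl m i z) =
      heis_act m (next_state i (refl_poly i, refl_vec i, False))
        (skew m (refl_poly i) (laurent_coeff (flip (refl_vec i) (refl_poly i)))) z"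
    using heis_refl_act [of m i "refl_poly i" "refl_vec i" False 0 z] by (simp add: heis_refl_def)
  also have "\<dots> = z"
  proof (cases "i = 2")
    case True
    obtain g s where z: "z = (g, s)" by force
    show ?thesis
      by (auto simp: z True heis_act_def next_state_def refl_poly_def refl_vec_def flip_def Let_def
          laurent_coeff_def skew_def fun_eq_iff zero_prod_def)
  next
    case False
    then show ?thesis
      using heis_act_trivial [of m] by (simp add: next_state_def refl_poly_def flip_def skew_def zero_prod_def)
  qed
  finally show ?thesis .
qed

lemma heis_refl_closed: "heis_refl m \<in> I \<rightarrow> carrier perm_group"
  by (auto intro!: involuntory_imp_bij heis_refl_involution simp del: split_paired_All)

lemma inv_heis_refl: "inv\<^bsub>perm_group\<^esub> (heis_refl m i) = heis_refl m i"
proof -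
  interpret group perm_group by (rule group_perm_group)
  show ?thesis
    by (rule inv_equality) (use heis_refl_closed [of m UNIV] in \<open>auto simp: fun_eq_iff heis_refl_involution\<close>)
qed

lemma word_eval_heis_Cons:
  "word_eval perm_group (heis_refl m) ((i, s) # w) z = word_eval perm_group (heis_refl m) w (heis_refl m i z)"
  by (simp add: inv_heis_refl)

text \<open>The \<open>X\<close>-exponents of \<open>refl_poly i\<close> are 0 or 1. Moved by
  \<open>m\<close> either way they have absolute value at least \<open>m - 1\<close>, outside the
  support of \<open>f\<close>.\<close>

lemma skew_far:
  assumes "snd ` set f \<subseteq> {u. \<bar>fst u\<bar> \<le> L}" "L + 1 < m"
  shows "skew m (refl_poly i) (laurent_coeff f) = 0"
proof -
  have "laurent_coeff f (k, l) = 0" if "L < \<bar>k\<bar>" for k l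
    using assms(1) that by (intro laurent_coeff_eq_0) auto
  then show ?thesis
    using assms(2) by (simp add: skew_def refl_poly_def)
qed

text \<open>Each letter raises the bound on \<open>X\<close>-exponents by at most one. Within the
  budget \<open>L + length w\<close> every central correction of \<open>heis_refl_act\<close> is
  0.\<close>

lemma word_eval_heis_short:
  assumes "snd ` set f \<subseteq> {u. \<bar>fst u\<bar> \<le> int L}" "int (L + length w) + 1 < m"
  shows "word_eval perm_group (heis_refl m) w (heis_act m (f, q, e) 0 z) =
         heis_act m (word_state w (f, q, e)) 0 z"
  using assms
proof (induction w arbitrary: f q e L)
  case (Cons x w)
  obtain i s where x: "x = (i, s)" by force
  have fl: "snd ` set (flip (refl_vec i) f) \<subseteq> {u. \<bar>fst u\<bar> \<le> int (Suc L)}"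
  proof
    fix v assume "v \<in> snd ` set (flip (refl_vec i) f)"
    then obtain c u where "(c, u) \<in> set f" and v: "v = refl_vec i - u"
      by (auto simp: flip_def)
    then have "\<bar>fst u\<bar> \<le> int L"
      using Cons.prems(1) by auto
    then show "v \<in> {u. \<bar>fst u\<bar> \<le> int (Suc L)}"
      by (simp add: v refl_vec_def abs_le_iff)
  qed
  then have next_f: "snd ` set (refl_poly i @ flip (refl_vec i) f) \<subseteq> {u. \<bar>fst u\<bar> \<le> int (Suc L)}"
    by (auto simp: refl_poly_def)
  have "heis_refl m i (heis_act m (f, q, e) 0 z) = heis_act m (next_state i (f, q, e)) 0 z"
    unfolding heis_refl_act using skew_far [OF fl, of m i] Cons.prems(2) by simp
  then show ?case
    using Cons.IH [OF next_f] Cons.prems(2)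
    by (simp add: x word_eval_heis_Cons next_state_def del: word_eval_simps)
qed (simp add: fun_eq_iff)

text \<open>Conjugation inverts numbers of modulus 1, so on values at \<open>(a, b)\<close> it acts
  by negating exponents.\<close>

lemma complex_act_next:
  assumes "cmod a = 1" "cmod b = 1"
  shows "complex_act a b (next_state i st) z =
    pairing (refl_poly i) (\<lambda>(i, j). a powi i * b powi j) +
    a powi fst (refl_vec i) * b powi snd (refl_vec i) * cnj (complex_act a b st z)"
proof -
  obtain f q e where st: "st = (f, q, e)" by (cases st)
  have nz: "a \<noteq> 0" "b \<noteq> 0" using assms by auto
  have cnj_unit: "cnj c = inverse c" if "cmod c = 1" for c
    using complex_norm_square [of c] that by (simp add: inverse_unique)
  note cnj = cnj_unit [OF assms(1)] cnj_unit [OF assms(2)]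
  have "pairing (flip (k, l) f) (\<lambda>(i, j). a powi i * b powi j) =
      a powi k * b powi l * cnj (pairing f (\<lambda>(i, j). a powi i * b powi j))" for k l
    by (induction f) (auto simp: flip_def cnj power_int_inverse power_int_diff nz field_simps)
  from this [of "fst (refl_vec i)" "snd (refl_vec i)"]
  show ?thesis
    by (simp add: st complex_act_def next_state_def cnj power_int_inverse power_int_diff nz field_simps)
qed

text \<open>Three points suffice: 0 isolates the translation, 1 the monomial, and
  \<open>\<i>\<close> separates rotations from reflections.\<close>

lemma complex_act_eq_id:
  assumes indep: "laurent_independent a b" and "complex_act a b (f, q, e) = id"
  shows "q = 0" "e" "pairing f \<phi> = (0 :: int)"
proof -
  have at: "complex_act a b (f, q, e) z = z" for z
    using assms(2) by simp
  have f: "pairing f (\<lambda>(i, j). a powi i * b powi j) = 0"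
    using at [of 0] by (auto simp: complex_act_def split: if_splits)
  have "a powi fst q * b powi snd q = 1"
    using at [of 1] f by (auto simp: complex_act_def split: if_splits)
  then show "q = 0" "e"
    using at [of \<i>] f laurent_independent_monomial [OF indep, of "fst q" "snd q"]
    by (auto simp: complex_act_def prod_eq_iff split: if_splits)
  show "pairing f \<phi> = 0"
    by (rule laurent_independent_pairing [OF indep f])
qed

lemma heis_relation_short:
  assumes "laurent_independent a b" "complex_act a b (word_state w ([], 0, True)) = id"
    and "int (length w) + 1 < m"
  shows "word_eval perm_group (heis_refl m) w = \<one>\<^bsub>perm_group\<^esub>"
proof -
  obtain f q e where st: "word_state w ([], 0, True) = (f, q, e)" by (metis prod_cases3)
  note triv = complex_act_eq_id [OF assms(1), of f q e, folded st, OF assms(2)]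
  have "word_eval perm_group (heis_refl m) w z = z" for z
  proof -
    have "word_eval perm_group (heis_refl m) w (heis_act m ([], 0, True) 0 z) = heis_act m (f, q, e) 0 z"
      using word_eval_heis_short [of "[]" 0 w m 0 True z] assms(3) by (simp add: st)
    also have "\<dots> = z"
      using triv by (auto simp: heis_act_def laurent_coeff_def skew_def Let_def split: prod.split)
    finally show ?thesis by (simp add: heis_act_trivial)
  qed
  then show ?thesis by (simp add: fun_eq_iff)
qed

section \<open>A plane relation that fails in the Heisenberg extension\<close>

definition rot_word :: "nat \<Rightarrow> (nat \<times> bool) list" where
  "rot_word i = [(1, True), (i, True)]"

definition comm_word :: "('a \<times> bool) list \<Rightarrow> ('a \<times> bool) list \<Rightarrow> ('a \<times> bool) list" where
  "comm_word u v = u @ v @ word_inv u @ word_inv v"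

fun conj_word :: "nat \<Rightarrow> (nat \<times> bool) list" where
  "conj_word 0 = comm_word (rot_word 2) (rot_word 3)"
| "conj_word (Suc n) = word_inv (rot_word 2) @ conj_word n @ rot_word 2"


lemma letters_conj_word: "letters (conj_word n) \<subseteq> {1, 2, 3}"
  by (induction n) (auto simp: comm_word_def rot_word_def)

lemma word_eval_heis_append:
  "word_eval perm_group (heis_refl m) (u @ v) z =
   word_eval perm_group (heis_refl m) v (word_eval perm_group (heis_refl m) u z)"
  using group.word_eval_append [OF group_perm_group heis_refl_closed [of m UNIV], of u v] by simp

lemma word_eval_heis_inv:
  "word_eval perm_group (heis_refl m) (word_inv w) (word_eval perm_group (heis_refl m) w z) = z"
  "word_eval perm_group (heis_refl m) w (word_eval perm_group (heis_refl m) (word_inv w) z) = z"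
proof -
  interpret group perm_group by (rule group_perm_group)
  have mem: "word_eval perm_group (heis_refl m) w \<in> carrier perm_group"
    by (rule word_eval_closed [OF heis_refl_closed [of m UNIV]]) simp
  have inv: "word_eval perm_group (heis_refl m) (word_inv w) = inv\<^bsub>perm_group\<^esub> (word_eval perm_group (heis_refl m) w)"
    by (rule word_eval_word_inv [OF heis_refl_closed [of m UNIV]]) simp
  show "word_eval perm_group (heis_refl m) (word_inv w) (word_eval perm_group (heis_refl m) w z) = z"
    using r_inv [OF mem] by (simp add: inv fun_eq_iff del: r_inv split_paired_All)
  show "word_eval perm_group (heis_refl m) w (word_eval perm_group (heis_refl m) (word_inv w) z) = z"
    using l_inv [OF mem] by (simp add: inv fun_eq_iff del: l_inv split_paired_All)
qed

text \<open>The central term stays unspecified, since it will cancel when two translations are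
  commuted.\<close>

lemma word_eval_heis_state:
  "\<exists>\<zeta>'. \<forall>z. word_eval perm_group (heis_refl m) w (heis_act m st \<zeta> z) = heis_act m (word_state w st) \<zeta>' z"
proof (induction w arbitrary: st \<zeta>)
  case (Cons x w)
  obtain i s where x: "x = (i, s)" by (cases x)
  obtain f q e where st: "st = (f, q, e)" by (cases st)
  show ?case
    using Cons.IH by (simp add: x st word_eval_heis_Cons heis_refl_act del: word_eval_simps split_paired_All)
qed auto

lemma word_eval_rot_word:
  "word_eval perm_group (heis_refl m) (rot_word 2) z = heis_act m (refl_poly 2, (1, 0), True) 0 z"
proof -
  have "heis_refl m 2 (heis_refl m 1 z) = heis_act m (refl_poly 2, (1, 0), True) 0 z"
    unfolding heis_refl_def [of m 1] heis_refl_act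
    by (simp add: next_state_def refl_vec_def refl_poly_def flip_def skew_def laurent_coeff_def)
  then show ?thesis
    by (simp add: rot_word_def word_eval_heis_Cons del: word_eval_simps) simp
qed

text \<open>Multiplication by a monomial preserves the form, so a lifted rotation conjugates lifted
  translations to lifted translations. Moving one map past the other avoids inverses.\<close>

lemma heis_translation_conj:
  fixes p :: point
  shows "heis_act m (f', p, True) 0 (heis_act m (f, 0, True) \<zeta> z) =
   heis_act m (shift p f, 0, True)
     (\<zeta> + skew m f' (laurent_coeff (shift p f)) - skew m (shift p f) (laurent_coeff f'))
     (heis_act m (f', p, True) 0 z)"
proof -
  obtain g s where z: "z = (g, s)" by (cases z)
  show ?thesis
    by (simp add: z heis_act_def Let_def skew_add laurent_coeff_shift [abs_def] skew_shift add_ac)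
qed

text \<open>The expansion of \<open>(1 - 1/X) * (1/Y - 1)\<close>, the translation of the commutator
  of the two rotations with \<open>X\<close> for \<open>a\<close> and \<open>Y\<close> for
  \<open>b\<close>.\<close>

definition comm_poly :: "(int \<times> point) list" where
  "comm_poly = [(1, (0, -1)), (-1, (-1, -1)), (1, (-1, 0)), (-1, (0, 0))]"

lemma word_eval_conj_word:
  "\<exists>\<zeta>. \<forall>z. word_eval perm_group (heis_refl m) (conj_word n) z =
     heis_act m (shift (int n, 0) comm_poly, 0, True) \<zeta> z"
proof (induction n)
  case 0
  have "word_state (conj_word 0) ([], 0, True) = (comm_poly, 0, True)"
    by (simp add: comm_word_def rot_word_def next_state_def refl_poly_def refl_vec_def flip_def
        comm_poly_def zero_prod_def)
  moreover have "shift (int 0, 0) comm_poly = comm_poly"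
    by (simp add: shift_def comm_poly_def zero_prod_def)
  ultimately show ?case
    using word_eval_heis_state [of m "conj_word 0" "([], 0, True)" 0]
    by (simp add: heis_act_trivial del: conj_word.simps split_paired_All)
next
  case (Suc n)
  then obtain \<zeta> where IH: "\<And>z. word_eval perm_group (heis_refl m) (conj_word n) z =
      heis_act m (shift (int n, 0) comm_poly, 0, True) \<zeta> z" by blast
  define s where "s = word_eval perm_group (heis_refl m) (rot_word 2)"
  define s' where "s' = word_eval perm_group (heis_refl m) (word_inv (rot_word 2))"
  define f where "f = shift (int n, 0) comm_poly"
  define \<zeta>' where "\<zeta>' = \<zeta> + skew m (refl_poly 2) (laurent_coeff (shift (1, 0) f)) -
      skew m (shift (1, 0) f) (laurent_coeff (refl_poly 2))"
  have s: "s z = heis_act m (refl_poly 2, (1, 0), True) 0 z" for z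
    unfolding s_def by (rule word_eval_rot_word)
  have shift: "shift (1, 0) f = shift (int (Suc n), 0) comm_poly"
    by (simp add: f_def shift_def comm_poly_def zero_prod_def)
  have "word_eval perm_group (heis_refl m) (conj_word (Suc n)) z =
      heis_act m (shift (1, 0) f, 0, True) \<zeta>' z" for z
  proof -
    have "word_eval perm_group (heis_refl m) (conj_word (Suc n)) z = s (heis_act m (f, 0, True) \<zeta> (s' z))"
      by (simp add: word_eval_heis_append s_def s'_def f_def IH)
    also have "\<dots> = heis_act m (shift (1, 0) f, 0, True) \<zeta>' (s (s' z))"
      unfolding s heis_translation_conj \<zeta>'_def ..
    also have "s (s' z) = z"
      unfolding s_def s'_def by (rule word_eval_heis_inv)
    finally show ?thesis .
  qed
  then show ?case
    unfolding shift by blast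
qed

text \<open>With \<open>m = n\<close> each monomial of \<open>comm_poly\<close> meets its own copy
  in the shifted polynomial, and \<open>3 < n\<close> excludes other encounters. The form is the sum
  of the squares of the four coefficients, 4 in one order and -4 in the other.\<close>

lemma heis_commutator_nontrivial:
  assumes "3 < n"
  shows "word_eval perm_group (heis_refl (int n)) (comm_word (conj_word 0) (conj_word n)) \<noteq> \<one>\<^bsub>perm_group\<^esub>"
proof
  define ev where "ev = word_eval perm_group (heis_refl (int n))"
  define f where "f = shift (int n, 0) comm_poly"
  assume "word_eval perm_group (heis_refl (int n)) (comm_word (conj_word 0) (conj_word n)) = \<one>\<^bsub>perm_group\<^esub>"
  then have "ev (word_inv (conj_word n)) (ev (word_inv (conj_word 0)) (ev (conj_word n) (ev (conj_word 0) z))) = z" for z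
    unfolding ev_def comm_word_def by (simp add: fun_eq_iff word_eval_heis_append del: conj_word.simps split_paired_All)
  then have comm: "ev (conj_word n) (ev (conj_word 0) z) = ev (conj_word 0) (ev (conj_word n) z)" for z
    unfolding ev_def by (metis word_eval_heis_inv(2))
  obtain \<zeta>\<^sub>0 where 0: "\<And>z. ev (conj_word 0) z = heis_act (int n) (shift (int 0, 0) comm_poly, 0, True) \<zeta>\<^sub>0 z"
    using word_eval_conj_word unfolding ev_def by blast
  obtain \<zeta> where n: "\<And>z. ev (conj_word n) z = heis_act (int n) (f, 0, True) \<zeta> z"
    using word_eval_conj_word unfolding ev_def f_def by blast
  have f0: "shift (int 0, 0) comm_poly = comm_poly"
    by (simp add: shift_def comm_poly_def zero_prod_def)
  have "skew (int n) f (laurent_coeff comm_poly) = skew (int n) comm_poly (laurent_coeff f)"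
    \<comment> \<open>At the origin both orders contribute the same central terms
      \<open>\<zeta>\<^sub>0\<close> and \<open>\<zeta>\<close>, so only the two values of the form
      are left to compare.\<close>
    using comm [of "(\<lambda>_. 0, 0)"] unfolding 0 n f0
    by (simp add: heis_act_def skew_zero)
  moreover have "skew (int n) comm_poly (laurent_coeff f) = 4"
    using assms by (simp add: skew_def laurent_coeff_def f_def shift_def comm_poly_def zero_prod_def)
  moreover have "skew (int n) f (laurent_coeff comm_poly) = - 4"
    using assms by (simp add: skew_def laurent_coeff_def f_def shift_def comm_poly_def zero_prod_def)
  ultimately show False by simp
qed

section \<open>Plane isometries\<close>

lemma E2_group_sel [simp]:
  "carrier E2_group = E2"
  "g \<otimes>\<^bsub>E2_group\<^esub> h = h \<circ> g"
  "\<one>\<^bsub>E2_group\<^esub> = id"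
  by (simp_all add: E2_group_def)

lemma E2_cases:
  assumes "f \<in> E2"
  obtains (rotation) a b where "cmod a = 1" "f = (\<lambda>z. a * z + b)"
    | (reflection) a b where "cmod a = 1" "f = (\<lambda>z. a * cnj z + b)"
  using assms unfolding E2_def by (elim CollectE exE conjE disjE)

lemma E2_rotation: "cmod a = 1 \<Longrightarrow> (\<lambda>z. a * z + b) \<in> E2"
  unfolding E2_def by (intro CollectI exI [of _ a] exI [of _ b]) simp

lemma E2_reflection: "cmod a = 1 \<Longrightarrow> (\<lambda>z. a * cnj z + b) \<in> E2"
  unfolding E2_def by (intro CollectI exI [of _ a] exI [of _ b]) simp

lemma unit_mult_cnj: "cmod a = 1 \<Longrightarrow> a * cnj a = 1"
  using complex_norm_square [of a] by simp

lemma unit_mult_cnj_cancel: "cmod a = 1 \<Longrightarrow> a * (cnj a * w) = w"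
  using unit_mult_cnj [of a] by (simp flip: mult.assoc)

lemma norm_unit_square: "w \<noteq> 0 \<Longrightarrow> cmod (unit_square w) = 1"
  by (simp add: unit_square_def norm_divide)

lemma group_E2: "group E2_group"
proof (rule groupI)
  fix f g assume "f \<in> carrier E2_group" "g \<in> carrier E2_group"
  then have fg: "f \<in> E2" "g \<in> E2" by simp_all
  have "g \<circ> f \<in> E2"
    using fg(1)
  proof (cases rule: E2_cases)
    case f: (rotation a b)
    from fg(2) show ?thesis
    proof (cases rule: E2_cases)
      case (rotation c d)
      then have "g \<circ> f = (\<lambda>z. (c * a) * z + (c * b + d))"
        by (simp add: f fun_eq_iff algebra_simps)
      with f rotation show ?thesis by (simp add: E2_rotation norm_mult)
    next
      case (reflection c d)
      then have "g \<circ> f = (\<lambda>z. (c * cnj a) * cnj z + (c * cnj b + d))"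
        by (simp add: f fun_eq_iff algebra_simps)
      with f reflection show ?thesis by (simp add: E2_reflection norm_mult)
    qed
  next
    case f: (reflection a b)
    from fg(2) show ?thesis
    proof (cases rule: E2_cases)
      case (rotation c d)
      then have "g \<circ> f = (\<lambda>z. (c * a) * cnj z + (c * b + d))"
        by (simp add: f fun_eq_iff algebra_simps)
      with f rotation show ?thesis by (simp add: E2_reflection norm_mult)
    next
      case (reflection c d)
      then have "g \<circ> f = (\<lambda>z. (c * cnj a) * z + (c * cnj b + d))"
        by (simp add: f fun_eq_iff algebra_simps)
      with f reflection show ?thesis by (simp add: E2_rotation norm_mult)
    qed
  qed
  then show "f \<otimes>\<^bsub>E2_group\<^esub> g \<in> carrier E2_group" by simp
next
  show "\<one>\<^bsub>E2_group\<^esub> \<in> carrier E2_group"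
    using E2_rotation [of 1 0] by (simp add: id_def)
next
  fix f assume "f \<in> carrier E2_group"
  then have "f \<in> E2" by simp
  then have "\<exists>g\<in>E2. f \<circ> g = id"
  proof (cases rule: E2_cases)
    case (rotation a b)
    have "f \<circ> (\<lambda>z. cnj a * z + - (cnj a * b)) = id"
      by (simp add: rotation fun_eq_iff right_diff_distrib unit_mult_cnj_cancel [OF rotation(1)])
    then show ?thesis
      using E2_rotation [of "cnj a" "- (cnj a * b)"] rotation(1) by (intro bexI) auto
  next
    case (reflection a b)
    have "f \<circ> (\<lambda>z. a * cnj z + - (a * cnj b)) = id"
      by (simp add: reflection fun_eq_iff right_diff_distrib unit_mult_cnj_cancel [OF reflection(1)])
    then show ?thesis
      using E2_reflection [of a "- (a * cnj b)"] reflection(1) by (intro bexI) auto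
  qed
  then show "\<exists>g\<in>carrier E2_group. g \<otimes>\<^bsub>E2_group\<^esub> f = \<one>\<^bsub>E2_group\<^esub>" by simp
qed (simp_all add: comp_assoc)

interpretation E2: group E2_group
  by (rule group_E2)

definition linear_part :: "(complex \<Rightarrow> complex) \<Rightarrow> complex" where
  "linear_part f = f 1 - f 0"

lemma SE2_apply: "f \<in> SE2 \<Longrightarrow> f z = linear_part f * z + f 0"
  by (auto simp: SE2_def linear_part_def)

lemma SE2_diff: "f \<in> SE2 \<Longrightarrow> f z - f w = linear_part f * (z - w)"
  using SE2_apply [of f z] SE2_apply [of f w] by (simp add: algebra_simps)

lemma linear_part_comp: "f \<in> SE2 \<Longrightarrow> linear_part (f \<circ> g) = linear_part f * linear_part g"
  using SE2_diff [of f "g 1" "g 0"] by (simp add: linear_part_def)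

lemma SE2_subset_E2: "SE2 \<subseteq> E2"
  by (auto simp: SE2_def E2_def)

lemma SE2_comp: "\<lbrakk>f \<in> SE2; g \<in> SE2\<rbrakk> \<Longrightarrow> f \<circ> g \<in> SE2"
proof -
  assume "f \<in> SE2" "g \<in> SE2"
  then obtain a b c d where "cmod a = 1" "f = (\<lambda>z. a * z + b)" "cmod c = 1" "g = (\<lambda>z. c * z + d)"
    unfolding SE2_def by blast
  then have "cmod (a * c) = 1" "f \<circ> g = (\<lambda>z. (a * c) * z + (a * d + b))"
    by (simp_all add: norm_mult fun_eq_iff algebra_simps)
  then show ?thesis unfolding SE2_def by blast
qed

lemma not_SE2_conjugation: "a \<noteq> 0 \<Longrightarrow> (\<lambda>z. a * cnj z + b) \<notin> SE2"
proof
  assume "a \<noteq> 0" "(\<lambda>z. a * cnj z + b) \<in> SE2"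
  from SE2_apply [OF this(2), of \<i>] have "a * \<i> = 0"
    by (simp add: linear_part_def)
  then show False using \<open>a \<noteq> 0\<close> by simp
qed

lemma subgroup_SE2: "subgroup SE2 E2_group"
proof (rule E2.subgroupI)
  have "id \<in> SE2"
    unfolding SE2_def by (intro CollectI exI [of _ 1] exI [of _ 0]) (simp add: id_def)
  then show "SE2 \<noteq> {}" by blast
  fix f assume f: "f \<in> SE2"
  then obtain a b where ab: "cmod a = 1" "f = (\<lambda>z. a * z + b)"
    unfolding SE2_def by blast
  define g where "g z = cnj a * z + - (cnj a * b)" for z
  have "f \<circ> g = id"
    by (simp add: ab(2) g_def fun_eq_iff right_diff_distrib unit_mult_cnj_cancel [OF ab(1)])
  moreover have g: "g \<in> SE2"
    unfolding SE2_def g_def [abs_def] using ab(1)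
    by (intro CollectI exI [of _ "cnj a"] exI [of _ "- (cnj a * b)"]) simp
  ultimately have "inv\<^bsub>E2_group\<^esub> f = g"
    using f SE2_subset_E2 by (intro E2.inv_equality) auto
  then show "inv\<^bsub>E2_group\<^esub> f \<in> SE2" using g by simp
qed (use SE2_subset_E2 SE2_comp in auto)

lemma SE2_inv: "f \<in> SE2 \<Longrightarrow> inv\<^bsub>E2_group\<^esub> f \<in> SE2"
  by (rule subgroup.m_inv_closed [OF subgroup_SE2])

lemma SE2_mult: "\<lbrakk>f \<in> SE2; g \<in> SE2\<rbrakk> \<Longrightarrow> f \<otimes>\<^bsub>E2_group\<^esub> g \<in> SE2"
  by (rule subgroup.m_closed [OF subgroup_SE2])

lemma linear_part_mult:
  "g \<in> SE2 \<Longrightarrow> linear_part (f \<otimes>\<^bsub>E2_group\<^esub> g) = linear_part f * linear_part g"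
  by (simp add: linear_part_comp)

lemma linear_part_inv: "f \<in> SE2 \<Longrightarrow> linear_part (inv\<^bsub>E2_group\<^esub> f) = inverse (linear_part f)"
proof -
  assume f: "f \<in> SE2"
  then have "inv\<^bsub>E2_group\<^esub> f \<otimes>\<^bsub>E2_group\<^esub> f = \<one>\<^bsub>E2_group\<^esub>"
    using SE2_subset_E2 by (intro E2.l_inv) auto
  then have "linear_part (inv\<^bsub>E2_group\<^esub> f \<otimes>\<^bsub>E2_group\<^esub> f) = 1"
    by (simp add: linear_part_def)
  then have "linear_part f * linear_part (inv\<^bsub>E2_group\<^esub> f) = 1"
    by (subst (asm) linear_part_mult [OF f]) (simp only: mult.commute)
  then show ?thesis by (rule inverse_unique [symmetric])
qed

lemma linear_part_nz: "f \<in> SE2 \<Longrightarrow> linear_part f \<noteq> 0"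
  by (auto simp: SE2_def linear_part_def)

lemma translations_commute:
  assumes "f \<in> SE2" "g \<in> SE2" "linear_part f = 1" "linear_part g = 1"
  shows "f \<otimes>\<^bsub>E2_group\<^esub> g = g \<otimes>\<^bsub>E2_group\<^esub> f"
proof
  fix z
  show "(f \<otimes>\<^bsub>E2_group\<^esub> g) z = (g \<otimes>\<^bsub>E2_group\<^esub> f) z"
    using SE2_apply [OF assms(1), of "g z"] SE2_apply [OF assms(2), of "f z"]
      SE2_apply [OF assms(1), of z] SE2_apply [OF assms(2), of z] assms(3,4) by simp
qed

lemma reflection_form:
  assumes "p \<noteq> q"
  obtains c where "cmod (unit_square (q - p)) = 1" "reflection p q = (\<lambda>z. unit_square (q - p) * cnj z + c)"
proof
  show "cmod (unit_square (q - p)) = 1"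
    using assms by (simp add: norm_unit_square)
  show "reflection p q = (\<lambda>z. unit_square (q - p) * cnj z + (p - unit_square (q - p) * cnj p))"
    unfolding reflection_def unit_square_def [symmetric] by (simp add: fun_eq_iff algebra_simps)
qed

lemma reflection_E2: "p \<noteq> q \<Longrightarrow> reflection p q \<in> E2"
  by (erule reflection_form) (simp add: E2_reflection)

lemma reflection_not_SE2: "p \<noteq> q \<Longrightarrow> reflection p q \<notin> SE2"
  by (erule reflection_form) (auto intro!: not_SE2_conjugation)

lemma reflection_involution: "p \<noteq> q \<Longrightarrow> reflection p q (reflection p q z) = z"
  by (simp add: reflection_def)

lemma reflection_inv: "p \<noteq> q \<Longrightarrow> inv\<^bsub>E2_group\<^esub> (reflection p q) = reflection p q"
  by (rule E2.inv_equality) (auto simp: reflection_E2 fun_eq_iff reflection_involution)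

lemma (in group) word_eval_subgroup:
  assumes "subgroup H G" "k \<in> S \<rightarrow> H" "letters w \<subseteq> S"
  shows "word_eval (G\<lparr>carrier := H\<rparr>) k w = word_eval G k w"
  using assms(3)
proof (induction w)
  case (Cons x w)
  obtain a s where x: "x = (a, s)" by (cases x)
  have "inv\<^bsub>G\<lparr>carrier := H\<rparr>\<^esub> (k a) = inv (k a)"
    using Cons.prems assms(2) x by (intro m_inv_consistent [OF assms(1)]) auto
  then show ?case
    using Cons by (simp add: x)
qed simp

section \<open>Triangle groups\<close>

locale generic_triangle_group =
  fixes A1 A2 A3 :: complex
  assumes nondeg: "Im ((A2 - A1) * cnj (A3 - A1)) \<noteq> 0"
    and generic: "generic_triangle A1 A2 A3"
begin

definition side where "side = A3 - A2"
definition vertex where "vertex = (A1 - A2) / (A3 - A2)"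
text \<open>In the chart the second and third sides have directions \<open>1 - vertex\<close> and
  \<open>vertex\<close>; \<open>a\<close> and \<open>b\<close> are the linear factors of the
  reflections in them.\<close>

definition a where "a = unit_square (1 - vertex)"
definition b where "b = unit_square vertex"
definition chart where "chart z = A2 + side * z" for z

text \<open>Every index other than 1 and 2 goes to the third reflection, so membership facts hold
  for words in arbitrary letters.\<close>

definition refl :: "nat \<Rightarrow> complex \<Rightarrow> complex" where
  "refl i = (if i = 1 then tri_refl1 A1 A2 A3 else if i = 2 then tri_refl2 A1 A2 A3 else tri_refl3 A1 A2 A3)"

abbreviation "ev \<equiv> word_eval E2_group refl"
definition rot2 where "rot2 = refl 1 \<otimes>\<^bsub>E2_group\<^esub> refl 2"
definition rot3 where "rot3 = refl 1 \<otimes>\<^bsub>E2_group\<^esub> refl 3"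

lemma side_nz: "side \<noteq> 0"
proof
  assume "side = 0"
  then have "A3 = A2" by (simp add: side_def)
  then show False using nondeg by (simp add: algebra_simps)
qed

lemma A1_eq: "A1 = chart vertex" and A2_eq: "A2 = chart 0" and A3_eq: "A3 = chart 1"
  using side_nz by (simp_all add: chart_def vertex_def side_def)

lemma vertex_diff: "A1 - A2 = side * vertex" "A1 - A3 = - (side * (1 - vertex))"
proof -
  show A12: "A1 - A2 = side * vertex"
    using side_nz by (simp add: vertex_def side_def)
  have "A1 - A3 = A1 - A2 - side"
    by (simp add: side_def)
  then show "A1 - A3 = - (side * (1 - vertex))"
    unfolding A12 by (simp add: algebra_simps)
qed

lemma Im_vertex: "Im vertex \<noteq> 0"
proof
  assume "Im vertex = 0"
  then have "vertex \<in> \<real>" by (simp add: complex_is_Real_iff)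
  then obtain v where v: "vertex = of_real v" by (auto elim: Reals_cases)
  have diff: "A2 - A1 = - (side * vertex)" "A3 - A1 = side * (1 - vertex)"
    using vertex_diff by (metis minus_diff_eq minus_minus)+
  have "(A2 - A1) * cnj (A3 - A1) = of_real (- v * (1 - v)) * (side * cnj side)"
    unfolding diff v by (simp add: algebra_simps)
  then have "Im ((A2 - A1) * cnj (A3 - A1)) = 0"
    by (metis Im_complex_of_real complex_norm_square of_real_mult)
  then show False using nondeg by simp
qed

lemma vertex_nz: "vertex \<noteq> 0" "1 - vertex \<noteq> 0"
  using Im_vertex by auto

text \<open>The scale of genericity and the length of the base merge into the single factor
  \<open>k * cmod side\<close>.\<close>

lemma independent: "laurent_independent a b"
proof -
  obtain k where k: "k > 0"
    "alg_indep3 (k * cmod (A2 - A3)) (k * cmod (A1 - A3)) (k * cmod (A1 - A2))"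
    using generic unfolding generic_triangle_def by blast
  have "A2 - A3 = - side"
    by (simp add: side_def)
  with vertex_diff have "cmod (A2 - A3) = cmod side" "cmod (A1 - A3) = cmod side * cmod (1 - vertex)"
    "cmod (A1 - A2) = cmod side * cmod vertex"
    by (simp_all only: norm_minus_cancel norm_mult)
  then have "alg_indep3 (k * cmod side) (k * cmod side * cmod (1 - vertex)) (k * cmod side * cmod vertex)"
    using k(2) by (simp add: mult.assoc)
  then show ?thesis
    unfolding a_def b_def by (rule laurent_independent_unit_squares [OF _ Im_vertex]) (use k side_nz in simp)
qed

lemma unit_ab: "cmod a = 1" "cmod b = 1"
  using vertex_nz by (simp_all add: a_def b_def norm_unit_square)

lemma distinct: "A2 \<noteq> A3" "A1 \<noteq> A3" "A1 \<noteq> A2"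
  using nondeg by (auto simp: algebra_simps)

lemma refl_E2: "refl i \<in> E2" and refl_inv: "inv\<^bsub>E2_group\<^esub> (refl i) = refl i"
  and refl_refl: "refl i \<otimes>\<^bsub>E2_group\<^esub> refl i = \<one>\<^bsub>E2_group\<^esub>" and refl_not_SE2: "refl i \<notin> SE2"
  using distinct
  by (simp_all add: refl_def tri_refl1_def tri_refl2_def tri_refl3_def reflection_E2 reflection_inv
      reflection_involution fun_eq_iff reflection_not_SE2)

lemma refl_closed: "refl \<in> I \<rightarrow> carrier E2_group"
  by (simp add: refl_E2)

lemma refl_chart:
  assumes "i \<in> {1, 2, 3}"
  shows "refl i (chart z) = chart (pairing (refl_poly i) (\<lambda>(i, j). a powi i * b powi j) +
      a powi fst (refl_vec i) * b powi snd (refl_vec i) * cnj z)"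
proof -
  have refl: "reflection (chart p) (chart q) (chart z) = chart (p + unit_square (q - p) * cnj (z - p))" for p q
  proof -
    have "chart q - chart p = side * (q - p)" "chart z - chart p = side * (z - p)"
      by (simp_all add: chart_def algebra_simps)
    then have "reflection (chart p) (chart q) (chart z)
        = chart p + (side * (q - p)) / cnj (side * (q - p)) * cnj (side * (z - p))"
      by (simp only: reflection_def)
    also have "\<dots> = chart p + side * (unit_square (q - p) * cnj (z - p))"
      using side_nz by (simp add: unit_square_def del: complex_cnj_diff)
    also have "\<dots> = chart (p + unit_square (q - p) * cnj (z - p))"
      by (simp add: chart_def distrib_left)
    finally show ?thesis .
  qed
  \<comment> \<open>These identities turn the constant terms into \<open>1 - a\<close> and 0: the
    second side passes through 1, the third through 0.\<close>
  have a: "a * (1 - cnj vertex) = 1 - vertex" and b: "b * cnj vertex = vertex"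
    using vertex_nz by (simp_all add: a_def b_def unit_square_def)
  have us: "unit_square (- vertex) = b" "unit_square 1 = 1"
    by (simp_all add: b_def unit_square_def)
  have "vertex + a * cnj (z - vertex) = 1 - a + a * cnj z" "vertex + b * cnj (z - vertex) = b * cnj z"
    using a b by (simp_all add: algebra_simps)
  moreover have "refl 1 (chart z) = chart (cnj z)"
    using refl [of 0 1] by (simp add: refl_def tri_refl1_def us flip: A2_eq A3_eq)
  moreover have "refl 2 (chart z) = chart (vertex + a * cnj (z - vertex))"
    using refl [of vertex 1] by (simp add: refl_def tri_refl2_def a_def flip: A1_eq A3_eq)
  moreover have "refl 3 (chart z) = chart (vertex + b * cnj (z - vertex))"
    using refl [of vertex 0] by (simp add: refl_def tri_refl3_def us flip: A1_eq A2_eq)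
  ultimately show ?thesis
    using assms by (auto simp: refl_poly_def refl_vec_def)
qed

lemma chart_inj: "chart z = chart w \<longleftrightarrow> z = w"
  using side_nz by (simp add: chart_def)

lemma ev_Cons: "ev ((i, s) # w) = refl i \<otimes>\<^bsub>E2_group\<^esub> ev w"
  by (simp add: refl_inv)

text \<open>One and the same \<open>word_state\<close> governs the isometries and their Heisenberg
  lifts, so a relation among reflections can be read off from states.\<close>

lemma ev_state:
  "letters w \<subseteq> {1, 2, 3} \<Longrightarrow>
   ev w (chart (complex_act a b st z)) = chart (complex_act a b (word_state w st) z)"
proof (induction w arbitrary: st)
  case (Cons x w)
  obtain i s where x: "x = (i, s)" by (cases x)
  have "refl i (chart (complex_act a b st z)) = chart (complex_act a b (next_state i st) z)"
    using Cons.prems by (subst complex_act_next [OF unit_ab]) (simp add: x refl_chart)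
  then show ?case
    using Cons by (simp add: x refl_inv)
qed simp

lemma ev_relation:
  assumes "letters w \<subseteq> {1, 2, 3}" "ev w = \<one>\<^bsub>E2_group\<^esub>"
  shows "complex_act a b (word_state w ([], 0, True)) = id"
proof
  fix z
  have "complex_act a b ([], 0, True) z = z"
    by (simp add: complex_act_def)
  then show "complex_act a b (word_state w ([], 0, True)) z = id z"
    using ev_state [OF assms(1), of "([], 0, True)" z] assms(2) by (simp add: chart_inj)
qed

lemma rot_chart: "rot2 (chart z) = chart (a * z + (1 - a))" "rot3 (chart z) = chart (b * z)"
  by (simp_all add: rot2_def rot3_def refl_chart) (simp_all add: refl_poly_def refl_vec_def add.commute)

lemma rot_SE2: "rot2 \<in> SE2" "rot3 \<in> SE2"
proof -
  define u where "u z = (z - A2) / side" for z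
  have side_u: "side * u z = z - A2" for z
    using side_nz by (simp add: u_def)
  then have chart_u: "z = chart (u z)" for z
    unfolding chart_def by simp
  have "rot2 = (\<lambda>z. a * z + (A2 + side * (1 - a) - a * A2))"
  proof
    fix z
    have "rot2 z = chart (a * u z + (1 - a))"
      unfolding rot_chart [symmetric] by (rule arg_cong [OF chart_u])
    also have "\<dots> = A2 + (a * (side * u z) + side * (1 - a))"
      by (simp add: chart_def algebra_simps)
    finally show "rot2 z = a * z + (A2 + side * (1 - a) - a * A2)"
      unfolding side_u by (simp add: algebra_simps)
  qed
  then show "rot2 \<in> SE2"
    using unit_ab unfolding SE2_def by blast
  have "rot3 = (\<lambda>z. b * z + (A2 - b * A2))"
  proof
    fix z
    have "rot3 z = chart (b * u z)"
      unfolding rot_chart [symmetric] by (rule arg_cong [OF chart_u])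
    also have "\<dots> = A2 + b * (side * u z)"
      by (simp add: chart_def algebra_simps)
    finally show "rot3 z = b * z + (A2 - b * A2)"
      unfolding side_u by (simp add: algebra_simps)
  qed
  then show "rot3 \<in> SE2"
    using unit_ab unfolding SE2_def by blast
qed

lemma linear_part_rot: "linear_part rot2 = a" "linear_part rot3 = b"
proof -
  have "side * linear_part f = f (chart 1) - f (chart 0)" if "f \<in> SE2" for f
    using SE2_diff [OF that, of "chart 1" "chart 0"] by (simp add: chart_def)
  from this [OF rot_SE2(1)] this [OF rot_SE2(2)]
  show "linear_part rot2 = a" "linear_part rot3 = b"
    using side_nz unfolding rot_chart by (simp_all add: chart_def algebra_simps)
qed

section \<open>The rotation subgroup and its generators\<close>

lemma subgroup_triangle: "subgroup (triangle_group_set A1 A2 A3) E2_group"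
  unfolding triangle_group_set_def
  using distinct by (intro E2.generate_is_subgroup)
    (simp add: tri_refl1_def tri_refl2_def tri_refl3_def reflection_E2)

lemma triangle_group_set_eq: "triangle_group_set A1 A2 A3 = generate E2_group (refl ` {1, 2, 3})"
  by (simp add: triangle_group_set_def refl_def insert_commute)

lemma triangle_group_words: "triangle_group_set A1 A2 A3 = ev ` {w. letters w \<subseteq> {1, 2, 3}}"
  unfolding triangle_group_set_eq by (rule E2.generate_eq_word_eval [OF refl_closed])

lemma subgroup_rot: "subgroup (generate E2_group {rot2, rot3}) E2_group"
  using rot_SE2 SE2_subset_E2 by (intro E2.generate_is_subgroup) auto

lemma refl_rot:
  "refl 2 = refl 1 \<otimes>\<^bsub>E2_group\<^esub> rot2" "refl 3 = refl 1 \<otimes>\<^bsub>E2_group\<^esub> rot3"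
  "refl 2 \<otimes>\<^bsub>E2_group\<^esub> refl 1 = inv\<^bsub>E2_group\<^esub> rot2" "refl 3 \<otimes>\<^bsub>E2_group\<^esub> refl 1 = inv\<^bsub>E2_group\<^esub> rot3"
proof -
  have mem: "refl i \<in> carrier E2_group" for i by (simp add: refl_E2)
  show "refl 2 = refl 1 \<otimes>\<^bsub>E2_group\<^esub> rot2" "refl 3 = refl 1 \<otimes>\<^bsub>E2_group\<^esub> rot3"
    unfolding rot2_def rot3_def using mem E2.m_assoc [OF mem mem mem] E2.l_one [OF mem] refl_refl by metis+
  show "refl 2 \<otimes>\<^bsub>E2_group\<^esub> refl 1 = inv\<^bsub>E2_group\<^esub> rot2" "refl 3 \<otimes>\<^bsub>E2_group\<^esub> refl 1 = inv\<^bsub>E2_group\<^esub> rot3"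
    unfolding rot2_def rot3_def using E2.inv_mult_group [OF mem mem] refl_inv by simp_all
qed

text \<open>The subgroup generated by the two rotations together with its coset at
  \<open>refl 1\<close> is closed under left multiplication by every reflection, by
  \<open>refl_rot\<close>.\<close>

lemma ev_rot_coset:
  assumes "letters w \<subseteq> {1, 2, 3}"
  defines "K \<equiv> generate E2_group {rot2, rot3}"
  shows "ev w \<in> K \<or> (\<exists>g\<in>K. ev w = refl 1 \<otimes>\<^bsub>E2_group\<^esub> g)"
  using assms(1)
proof (induction w)
  case Nil
  then show ?case by (simp add: K_def generate.one del: E2_group_sel)
next
  case (Cons x w)
  obtain i s where x: "x = (i, s)" by (cases x)
  have mem: "refl i \<in> carrier E2_group" for i by (simp add: refl_E2)
  have K_mem: "g \<in> carrier E2_group" if "g \<in> K" for g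
    using that subgroup.mem_carrier [OF subgroup_rot] unfolding K_def by blast
  have rot_K: "rot2 \<in> K" "rot3 \<in> K" "inv\<^bsub>E2_group\<^esub> rot2 \<in> K" "inv\<^bsub>E2_group\<^esub> rot3 \<in> K"
    unfolding K_def by (auto intro: generate.incl generate.inv)
  have K_mult: "g \<otimes>\<^bsub>E2_group\<^esub> h \<in> K" if "g \<in> K" "h \<in> K" for g h
    using that unfolding K_def by (rule generate.eng)
  have i: "i = 1 \<or> i = 2 \<or> i = 3" using Cons.prems x by auto
  have "letters w \<subseteq> {1, 2, 3}" using Cons.prems by simp
  from Cons.IH [OF this] show ?case
  proof
    assume w: "ev w \<in> K"
    have "refl i \<otimes>\<^bsub>E2_group\<^esub> ev w = refl 1 \<otimes>\<^bsub>E2_group\<^esub> ev w \<or>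
      refl i \<otimes>\<^bsub>E2_group\<^esub> ev w = refl 1 \<otimes>\<^bsub>E2_group\<^esub> (rot2 \<otimes>\<^bsub>E2_group\<^esub> ev w) \<or>
      refl i \<otimes>\<^bsub>E2_group\<^esub> ev w = refl 1 \<otimes>\<^bsub>E2_group\<^esub> (rot3 \<otimes>\<^bsub>E2_group\<^esub> ev w)"
      using i refl_rot(1,2) E2.m_assoc [OF mem K_mem K_mem] rot_K w by metis
    then show ?case
      unfolding x ev_Cons using K_mult rot_K w by blast
  next
    assume "\<exists>g\<in>K. ev w = refl 1 \<otimes>\<^bsub>E2_group\<^esub> g"
    then obtain g where g: "g \<in> K" "ev w = refl 1 \<otimes>\<^bsub>E2_group\<^esub> g" by blast
    have "refl i \<otimes>\<^bsub>E2_group\<^esub> ev w = (refl i \<otimes>\<^bsub>E2_group\<^esub> refl 1) \<otimes>\<^bsub>E2_group\<^esub> g"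
      unfolding g(2) by (rule E2.m_assoc [OF mem mem K_mem [OF g(1)], symmetric])
    moreover have "refl i \<otimes>\<^bsub>E2_group\<^esub> refl 1 \<in> K"
      using i refl_rot(3,4) refl_refl rot_K generate.one [of E2_group "{rot2, rot3}"]
      unfolding K_def by metis
    ultimately show ?case
      unfolding x ev_Cons using K_mult g(1) by metis
  qed
qed

text \<open>An orientation-preserving element in the coset of \<open>refl 1\<close> would make
  \<open>refl 1\<close> itself orientation-preserving.\<close>

lemma rotation_subgroup_generated:
  "triangle_group_set A1 A2 A3 \<inter> SE2 = generate E2_group {rot2, rot3}"
proof
  have mem: "refl i \<in> triangle_group_set A1 A2 A3" if "i \<in> {1, 2, 3}" for i
    unfolding triangle_group_set_eq using that by (intro generate.incl) blast
  show "generate E2_group {rot2, rot3} \<subseteq> triangle_group_set A1 A2 A3 \<inter> SE2"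
  proof (rule E2.generate_subgroup_incl)
    show "{rot2, rot3} \<subseteq> triangle_group_set A1 A2 A3 \<inter> SE2"
      using rot_SE2 mem subgroup.m_closed [OF subgroup_triangle] by (simp add: rot2_def rot3_def)
    show "subgroup (triangle_group_set A1 A2 A3 \<inter> SE2) E2_group"
      by (rule E2.subgroups_Inter_pair [OF subgroup_triangle subgroup_SE2])
  qed
  show "triangle_group_set A1 A2 A3 \<inter> SE2 \<subseteq> generate E2_group {rot2, rot3}"
  proof
    fix f assume f: "f \<in> triangle_group_set A1 A2 A3 \<inter> SE2"
    then obtain w where w: "letters w \<subseteq> {1, 2, 3}" "f = ev w"
      unfolding triangle_group_words by blast
    show "f \<in> generate E2_group {rot2, rot3}"
    proof (rule ccontr)
      assume "f \<notin> generate E2_group {rot2, rot3}"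
      then obtain g where g: "g \<in> generate E2_group {rot2, rot3}" "f = refl 1 \<otimes>\<^bsub>E2_group\<^esub> g"
        using ev_rot_coset [OF w(1)] w(2) by blast
      have "generate E2_group {rot2, rot3} \<subseteq> SE2"
        using rot_SE2 by (intro E2.generate_subgroup_incl [OF _ subgroup_SE2]) simp
      then have gS: "g \<in> SE2" using g(1) by blast
      have gE: "g \<in> carrier E2_group" using gS SE2_subset_E2 by auto
      have "refl 1 = f \<otimes>\<^bsub>E2_group\<^esub> inv\<^bsub>E2_group\<^esub> g"
        unfolding g(2) using E2.m_assoc [of "refl 1" g "inv\<^bsub>E2_group\<^esub> g"] gE refl_E2
          E2.r_inv [OF gE] E2.r_one [of "refl 1"] by (metis E2_group_sel(1) E2.inv_closed)
      then have "refl 1 \<in> SE2"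
        using SE2_mult [OF _ SE2_inv [OF gS], of f] f by simp
      then show False using refl_not_SE2 by blast
    qed
  qed
qed

section \<open>Failure of finite presentability\<close>

lemma ev_append: "ev (u @ v) = ev u \<otimes>\<^bsub>E2_group\<^esub> ev v"
  by (rule E2.word_eval_append [OF refl_closed [of UNIV]]) simp_all

lemma ev_inv: "ev (word_inv w) = inv\<^bsub>E2_group\<^esub> (ev w)"
  by (rule E2.word_eval_word_inv [OF refl_closed [of UNIV]]) simp

lemma ev_mem: "ev w \<in> carrier E2_group"
  by (rule E2.word_eval_closed [OF refl_closed [of UNIV]]) simp

lemma ev_rot_word: "ev (rot_word 2) = rot2" "ev (rot_word 3) = rot3"
  by (simp_all add: rot_word_def rot2_def rot3_def)

lemma ev_conj_word: "ev (conj_word n) \<in> SE2 \<and> linear_part (ev (conj_word n)) = 1"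
proof (induction n)
  case 0
  have "linear_part rot2 \<noteq> 0" "linear_part rot3 \<noteq> 0"
    using rot_SE2 linear_part_nz by blast+
  then show ?case
    by (simp add: comm_word_def ev_append ev_inv ev_rot_word rot_SE2 SE2_mult SE2_inv
        linear_part_mult linear_part_inv field_simps del: E2_group_sel)
next
  case (Suc n)
  have "linear_part rot2 \<noteq> 0"
    using rot_SE2 linear_part_nz by blast+
  then show ?case
    using Suc by (simp add: ev_append ev_inv ev_rot_word rot_SE2 SE2_mult SE2_inv
        linear_part_mult linear_part_inv field_simps del: E2_group_sel)
qed

lemma ev_metabelian_relation: "ev (comm_word (conj_word 0) (conj_word n)) = \<one>\<^bsub>E2_group\<^esub>"
proof -
  define f g where "f = ev (conj_word 0)" and "g = ev (conj_word n)"
  have mem: "f \<in> carrier E2_group" "g \<in> carrier E2_group"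
    unfolding f_def g_def by (rule ev_mem)+
  have "f \<otimes>\<^bsub>E2_group\<^esub> g = g \<otimes>\<^bsub>E2_group\<^esub> f"
    unfolding f_def g_def using ev_conj_word by (intro translations_commute) blast+
  then have "f \<otimes>\<^bsub>E2_group\<^esub> (g \<otimes>\<^bsub>E2_group\<^esub> (inv\<^bsub>E2_group\<^esub> f \<otimes>\<^bsub>E2_group\<^esub> inv\<^bsub>E2_group\<^esub> g))
      = g \<otimes>\<^bsub>E2_group\<^esub> f \<otimes>\<^bsub>E2_group\<^esub> (inv\<^bsub>E2_group\<^esub> f \<otimes>\<^bsub>E2_group\<^esub> inv\<^bsub>E2_group\<^esub> g)"
    using mem by (metis E2.m_assoc E2.inv_closed E2.m_closed)
  also have "\<dots> = \<one>\<^bsub>E2_group\<^esub>"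
    using mem by (metis E2.inv_mult_group E2.r_inv E2.m_closed)
  finally show ?thesis
    unfolding comm_word_def ev_append ev_inv f_def g_def .
qed

theorem not_finitely_presented: "\<not> finitely_presented (triangle_group A1 A2 A3)"
proof
  assume fp: "finitely_presented (triangle_group A1 A2 A3)"
  define G where "G = triangle_group A1 A2 A3"
  have G: "G = E2_group\<lparr>carrier := triangle_group_set A1 A2 A3\<rparr>"
    by (simp add: G_def triangle_group_def)
  have grp: "group G"
    unfolding G by (rule subgroup.subgroup_is_group [OF subgroup_triangle group_E2])
  have refl_G: "refl \<in> {1, 2, 3} \<rightarrow> triangle_group_set A1 A2 A3"
    unfolding triangle_group_set_eq by (auto intro: generate.incl)
  have ev_G: "word_eval G refl w = ev w" if "letters w \<subseteq> {1, 2, 3}" for w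
    unfolding G by (rule E2.word_eval_subgroup [OF subgroup_triangle refl_G that])
  have gen: "carrier G = generate G (refl ` {1, 2, 3})"
    using E2.generate_consistent [OF _ subgroup_triangle, of "refl ` {1, 2, 3}"] refl_G
    by (simp add: G triangle_group_set_eq image_subset_iff Pi_iff)
  have "refl \<in> {1, 2, 3} \<rightarrow> carrier G"
    using refl_G by (simp add: G)
  from finitely_presented_finite_relations [OF grp _ this gen fp [folded G_def]]
  obtain \<Phi> :: "(nat \<times> bool) list set" where "finite \<Phi>"
    and rel: "\<And>w. w \<in> \<Phi> \<Longrightarrow> letters w \<subseteq> {1, 2, 3} \<and> word_eval G refl w = \<one>\<^bsub>G\<^esub>"
    and univ: "\<And>(K :: ((point \<Rightarrow> int) \<times> int \<Rightarrow> (point \<Rightarrow> int) \<times> int) monoid) k w.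
      \<lbrakk>group K; k \<in> {1, 2, 3} \<rightarrow> carrier K; \<And>v. v \<in> \<Phi> \<Longrightarrow> word_eval K k v = \<one>\<^bsub>K\<^esub>;
       letters w \<subseteq> {1, 2, 3}; word_eval G refl w = \<one>\<^bsub>G\<^esub>\<rbrakk> \<Longrightarrow> word_eval K k w = \<one>\<^bsub>K\<^esub>"
    by (metis finite.emptyI finite.insertI)
  \<comment> \<open>The margin 4 above the longest relator serves both
    \<open>int (length v) + 1 < int n\<close> for the surviving relators and \<open>3 < n\<close>
    for the commutator that is lost; the inserted 0 covers an empty \<open>\<Phi>\<close>.\<close>
  define n where "n = Max (insert 0 (length ` \<Phi>)) + 4"
  have n: "length w + 4 \<le> n" if "w \<in> \<Phi>" for w
    using that \<open>finite \<Phi>\<close> unfolding n_def by simp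
  define w where "w = comm_word (conj_word 0) (conj_word n)"
  have w: "letters w \<subseteq> {1, 2, 3}"
    using letters_conj_word [of 0] letters_conj_word [of n] by (simp add: w_def comm_word_def del: conj_word.simps)
  have one: "\<one>\<^bsub>G\<^esub> = \<one>\<^bsub>E2_group\<^esub>"
    by (simp add: G)
  have "word_eval perm_group (heis_refl (int n)) w = \<one>\<^bsub>perm_group\<^esub>"
  proof (rule univ [OF group_perm_group heis_refl_closed _ w])
    show "word_eval G refl w = \<one>\<^bsub>G\<^esub>"
      unfolding ev_G [OF w] one unfolding w_def by (rule ev_metabelian_relation)
    fix v assume v: "v \<in> \<Phi>"
    then have "letters v \<subseteq> {1, 2, 3}" "ev v = \<one>\<^bsub>E2_group\<^esub>"
      using rel ev_G one by metis+
    then show "word_eval perm_group (heis_refl (int n)) v = \<one>\<^bsub>perm_group\<^esub>"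
      using n [OF v] by (intro heis_relation_short [OF independent ev_relation]) auto
  qed
  moreover have "3 < n" by (simp add: n_def)
  ultimately show False
    using heis_commutator_nontrivial unfolding w_def by blast
qed

section \<open>The kernel of the map from the free group to the rotations\<close>

definition free_rot :: "bool \<Rightarrow> complex \<Rightarrow> complex" where
  "free_rot x = (if x then rot3 else rot2)"

abbreviation "fev \<equiv> word_eval E2_group free_rot"

lemma free_rot_SE2: "free_rot x \<in> SE2"
  by (simp add: free_rot_def rot_SE2)

lemma fev_hom: "fev \<in> hom F2 E2_group"
  using free_rot_SE2 SE2_subset_E2 by (intro E2.word_eval_hom) auto

lemma fev_SE2: "fev w \<in> SE2"
proof (induction w)
  case Nil
  show ?case using subgroup.one_closed [OF subgroup_SE2] by (simp only: word_eval_simps)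
next
  case (Cons x w)
  then show ?case
    by (cases x) (simp add: SE2_mult SE2_inv free_rot_SE2 del: E2_group_sel)
qed

lemma fev_fgen: "fev (fgen x) = free_rot x"
  by (simp add: fgen_def)

lemma fev_image: "fev ` carrier F2 = generate E2_group {rot2, rot3}"
proof -
  have closed: "free_rot \<in> UNIV \<rightarrow> carrier E2_group"
    using free_rot_SE2 SE2_subset_E2 by auto
  have "fev w \<in> fev ` carrier F2" for w
    using E2.word_eval_reduce [OF closed, of w] reduce_in_free_group [of w UNIV]
    by (intro image_eqI [of _ _ "reduce w"]) auto
  moreover have "generate E2_group (free_rot ` UNIV) = range fev"
    using E2.generate_eq_word_eval [OF closed] by simp
  moreover have "free_rot ` UNIV = {rot2, rot3}"
    by (auto simp: free_rot_def UNIV_bool)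
  ultimately show ?thesis by auto
qed

interpretation F2: group F2
  by (rule group_free_group)

interpretation fev: group_hom F2 E2_group fev
  by unfold_locales (rule fev_hom)

lemma second_derived_normal: "second_derived F2 \<lhd> F2"
  unfolding second_derived_def by (intro F2.derived_is_normal F2.derived_self_is_normal)

lemma derived_linear_part: "w \<in> derived F2 (carrier F2) \<Longrightarrow> linear_part (fev w) = 1"
proof -
  have mult: "linear_part (fev (u \<otimes>\<^bsub>F2\<^esub> v)) = linear_part (fev u) * linear_part (fev v)"
    if "u \<in> carrier F2" "v \<in> carrier F2" for u v
    using fev.hom_mult [OF that] linear_part_mult [OF fev_SE2] by (simp del: free_group_sel E2_group_sel)
  have inv: "linear_part (fev (inv\<^bsub>F2\<^esub> u)) = inverse (linear_part (fev u))" if "u \<in> carrier F2" for u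
    using fev.hom_inv [OF that] linear_part_inv [OF fev_SE2] by (simp del: free_group_sel E2_group_sel)
  have "subgroup {w \<in> carrier F2. linear_part (fev w) = 1} F2"
  proof (rule F2.subgroupI)
    have "\<one>\<^bsub>F2\<^esub> \<in> {w \<in> carrier F2. linear_part (fev w) = 1}"
      by (simp add: linear_part_def)
    then show "{w \<in> carrier F2. linear_part (fev w) = 1} \<noteq> {}" by blast
  qed (auto simp: mult inv simp del: free_group_sel fev.hom_mult fev.hom_inv)
  moreover have "derived_set F2 (carrier F2) \<subseteq> {w \<in> carrier F2. linear_part (fev w) = 1}"
    by (auto simp: mult inv linear_part_nz fev_SE2 field_simps
        simp del: free_group_sel fev.hom_mult fev.hom_inv)
  ultimately have "derived F2 (carrier F2) \<subseteq> {w \<in> carrier F2. linear_part (fev w) = 1}"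
    unfolding derived_def by (intro F2.generate_subgroup_incl)
  then show "w \<in> derived F2 (carrier F2) \<Longrightarrow> linear_part (fev w) = 1" by blast
qed

text \<open>Elements of the derived subgroup go to translations, and translations commute.\<close>

lemma second_derived_subset_kernel: "second_derived F2 \<subseteq> kernel F2 E2_group fev"
  unfolding second_derived_def derived_def [of F2 "derived F2 (carrier F2)"]
proof (rule F2.generate_subgroup_incl [OF _ fev.subgroup_kernel], clarsimp simp del: free_group_sel)
  fix u v assume uv: "u \<in> derived F2 (carrier F2)" "v \<in> derived F2 (carrier F2)"
  have mem: "u \<in> carrier F2" "v \<in> carrier F2"
    using uv F2.derived_in_carrier [of "carrier F2"] by auto
  define f g where "f = fev u" and "g = fev v"
  have fg: "f \<in> carrier E2_group" "g \<in> carrier E2_group"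
    unfolding f_def g_def using mem by (simp_all only: fev.hom_closed)
  have comm: "f \<otimes>\<^bsub>E2_group\<^esub> g = g \<otimes>\<^bsub>E2_group\<^esub> f"
    unfolding f_def g_def using uv by (intro translations_commute fev_SE2 derived_linear_part)
  have "fev (u \<otimes>\<^bsub>F2\<^esub> v \<otimes>\<^bsub>F2\<^esub> inv\<^bsub>F2\<^esub> u \<otimes>\<^bsub>F2\<^esub> inv\<^bsub>F2\<^esub> v)
      = f \<otimes>\<^bsub>E2_group\<^esub> g \<otimes>\<^bsub>E2_group\<^esub> inv\<^bsub>E2_group\<^esub> f \<otimes>\<^bsub>E2_group\<^esub> inv\<^bsub>E2_group\<^esub> g"
    using mem by (simp add: f_def g_def del: free_group_sel E2_group_sel)
  also have "\<dots> = g \<otimes>\<^bsub>E2_group\<^esub> (f \<otimes>\<^bsub>E2_group\<^esub> inv\<^bsub>E2_group\<^esub> f) \<otimes>\<^bsub>E2_group\<^esub> inv\<^bsub>E2_group\<^esub> g"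
    unfolding comm using E2.m_assoc [OF fg(2,1) E2.inv_closed [OF fg(1)]] by (simp del: E2_group_sel)
  also have "\<dots> = \<one>\<^bsub>E2_group\<^esub>"
    unfolding E2.r_inv [OF fg(1)] E2.r_one [OF fg(2)] by (rule E2.r_inv [OF fg(2)])
  finally show "u \<otimes>\<^bsub>F2\<^esub> v \<otimes>\<^bsub>F2\<^esub> inv\<^bsub>F2\<^esub> u \<otimes>\<^bsub>F2\<^esub> inv\<^bsub>F2\<^esub> v \<in> kernel F2 E2_group fev"
    using mem unfolding kernel_def by (simp del: free_group_sel E2_group_sel)
qed

lemma F2_generated: "carrier F2 = generate F2 {fgen False, fgen True}"
proof -
  have closed: "fgen \<in> (UNIV :: bool set) \<rightarrow> carrier F2"
    by (simp add: fgen_def)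
  have "carrier F2 \<subseteq> generate F2 (fgen ` UNIV)"
  proof
    fix w assume "w \<in> carrier F2"
    then have "w = word_eval F2 fgen w"
      using word_eval_fgen [of w UNIV] by (simp add: reduce_reduced)
    then show "w \<in> generate F2 (fgen ` UNIV)"
      unfolding F2.generate_eq_word_eval [OF closed] by (rule image_eqI) simp
  qed
  moreover have "generate F2 (fgen ` UNIV) \<subseteq> carrier F2"
    using closed by (intro F2.generate_incl) blast
  ultimately show ?thesis
    by (simp add: UNIV_bool)
qed

text \<open>The map induced on the quotient by the second derived subgroup is an affine action of
  the kind treated in \<open>affine_metabelian\<close>, hence faithful.\<close>

lemma kernel_subset_second_derived: "kernel F2 E2_group fev \<subseteq> second_derived F2"
proof
  define N where "N = second_derived F2"
  interpret N: normal N F2 unfolding N_def by (rule second_derived_normal)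
  define M where "M = F2 Mod N"
  interpret M: group M unfolding M_def by (rule N.factorgroup_is_group)
  define q where "q w = N #>\<^bsub>F2\<^esub> w" for w
  have "q \<in> hom F2 M"
    unfolding M_def q_def [abs_def] by (rule N.r_coset_hom_Mod)
  then interpret q: group_hom F2 M q
    by unfold_locales
  obtain h where h_hom: "h \<in> hom M E2_group" and h: "\<And>w. w \<in> carrier F2 \<Longrightarrow> h (q w) = fev w"
    using fev.FactGroup_universal_kernel [OF second_derived_normal second_derived_subset_kernel]
    unfolding M_def N_def q_def by blast
  have M_carrier: "carrier M = q ` carrier F2"
    unfolding M_def q_def by (rule carrier_FactGroup)
  have h_SE2: "h m \<in> SE2" if "m \<in> carrier M" for m
    using that h fev_SE2 unfolding M_carrier by auto
  have h_mult: "h (m \<otimes>\<^bsub>M\<^esub> m') = h m \<otimes>\<^bsub>E2_group\<^esub> h m'" if "m \<in> carrier M" "m' \<in> carrier M" for m m'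
    using that h_hom by (rule hom_mult [rotated])
  have gen: "fgen x \<in> carrier F2" for x :: bool
    by (simp add: fgen_def)
  have h_gen: "h (q (fgen x)) = free_rot x" for x
    using h [OF gen] by (simp add: fev_fgen)
  \<comment> \<open>Since \<open>A2\<close> is the origin of the chart, the chart coordinate of its
    image is the translation part.\<close>
  interpret affine_metabelian M "q (fgen False)" "q (fgen True)"
    "\<lambda>m. linear_part (h m)" "\<lambda>m. (h m A2 - A2) / side" a b
  proof (unfold_locales, goal_cases)
    case 1
    show ?case by (rule q.hom_closed [OF gen])
  next
    case 2
    show ?case by (rule q.hom_closed [OF gen])
  next
    case 3
    show ?case
      using q.generate_img [of "{fgen False, fgen True}"] gen
      unfolding F2_generated [symmetric] M_carrier by simp
  next
    case (4 d d')
    have img: "derived M (carrier M) = q ` derived F2 (carrier F2)"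
      unfolding M_carrier by (rule q.derived_img) simp
    obtain u where u: "u \<in> derived F2 (carrier F2)" "d = q u"
      using 4(1) unfolding img by (rule imageE)
    obtain v where v: "v \<in> derived F2 (carrier F2)" "d' = q v"
      using 4(2) unfolding img by (rule imageE)
    have mem: "u \<in> carrier F2" "v \<in> carrier F2"
      using u v F2.derived_in_carrier [of "carrier F2"] by auto
    have "u \<otimes>\<^bsub>F2\<^esub> v \<otimes>\<^bsub>F2\<^esub> inv\<^bsub>F2\<^esub> u \<otimes>\<^bsub>F2\<^esub> inv\<^bsub>F2\<^esub> v \<in> N"
      unfolding N_def second_derived_def derived_def [of F2 "derived F2 (carrier F2)"]
      using u(1) v(1) by (intro generate.incl) blast
    then have "q (u \<otimes>\<^bsub>F2\<^esub> v \<otimes>\<^bsub>F2\<^esub> inv\<^bsub>F2\<^esub> u \<otimes>\<^bsub>F2\<^esub> inv\<^bsub>F2\<^esub> v) = \<one>\<^bsub>M\<^esub>"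
      unfolding q_def M_def by (simp add: N.rcos_const del: free_group_sel)
    then have "q u \<otimes>\<^bsub>M\<^esub> q v \<otimes>\<^bsub>M\<^esub> inv\<^bsub>M\<^esub> (q u) \<otimes>\<^bsub>M\<^esub> inv\<^bsub>M\<^esub> (q v) = \<one>\<^bsub>M\<^esub>"
      using mem by (simp del: free_group_sel)
    then have "q u \<otimes>\<^bsub>M\<^esub> q v \<otimes>\<^bsub>M\<^esub> inv\<^bsub>M\<^esub> (q v \<otimes>\<^bsub>M\<^esub> q u) = \<one>\<^bsub>M\<^esub>"
      using mem by (simp add: M.inv_mult_group M.m_assoc del: free_group_sel)
    then show ?case
      unfolding u v using mem q.hom_closed M.m_closed M.inv_equality M.inv_inv M.inv_closed by metis
  next
    case (5 g g')
    then show ?case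
      using h_mult linear_part_mult h_SE2 by (simp del: E2_group_sel)
  next
    case (6 g g')
    have "h (g \<otimes>\<^bsub>M\<^esub> g') A2 = h g' (h g A2)"
      using h_mult [OF 6] by simp
    also have "\<dots> = h g' A2 + linear_part (h g') * (h g A2 - A2)"
      using SE2_diff [OF h_SE2 [OF 6(2)], of "h g A2" A2] by (simp add: algebra_simps)
    finally have eq: "h (g \<otimes>\<^bsub>M\<^esub> g') A2 = h g' A2 + linear_part (h g') * (h g A2 - A2)" .
    show ?case
      unfolding eq using side_nz by (simp add: field_simps)
  next
    case 7
    show ?case by (simp add: h_gen free_rot_def linear_part_rot)
  next
    case 8
    show ?case by (simp add: h_gen free_rot_def linear_part_rot)
  next
    case 9
    have "rot2 A2 - A2 = side * (1 - a)"
      using rot_chart(1) [of 0] by (simp add: chart_def)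
    then show ?case
      using side_nz by (simp add: h_gen free_rot_def)
  next
    case 10
    have "rot3 A2 = A2"
      using rot_chart(2) [of 0] by (simp add: chart_def)
    then show ?case by (simp add: h_gen free_rot_def)
  next
    case 11
    show ?case using unit_ab by auto
  next
    case 12
    show ?case using unit_ab by auto
  next
    case 13
    show ?case by (rule independent)
  qed
  fix w assume w: "w \<in> kernel F2 E2_group fev"
  then have mem: "w \<in> carrier F2" and "h (q w) = id"
    using h by (auto simp: kernel_def simp del: free_group_sel)
  then have "q w = \<one>\<^bsub>M\<^esub>"
    using q.hom_closed [OF mem] by (intro affine_faithful) (simp_all add: linear_part_def)
  then show "w \<in> second_derived F2"
    unfolding N_def [symmetric] q_def M_def
    using mem F2.coset_join1 [OF _ mem N.is_subgroup] by simp
qed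

theorem rotation_subgroup_iso:
  "\<exists>\<phi> \<in> iso (rotation_subgroup A1 A2 A3) free_metabelian2.
     \<phi> rot2 = second_derived F2 #>\<^bsub>F2\<^esub> fgen False \<and> \<phi> rot3 = second_derived F2 #>\<^bsub>F2\<^esub> fgen True"
proof -
  define H where "H = rotation_subgroup A1 A2 A3"
  define N where "N = second_derived F2"
  have H: "H = E2_group\<lparr>carrier := generate E2_group {rot2, rot3}\<rparr>"
    by (simp add: H_def rotation_subgroup_def rotation_subgroup_generated)
  have grp: "group H"
    unfolding H by (rule subgroup.subgroup_is_group [OF subgroup_rot group_E2])
  have hom: "fev \<in> hom F2 H"
    using fev_hom fev_image by (auto simp: hom_def H simp del: free_group_sel)
  interpret fH: group_hom F2 H fev
    using grp hom by (intro group_hom.intro group_free_group) (simp_all add: group_hom_axioms_def)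
  have ker: "kernel F2 H fev = N"
    using second_derived_subset_kernel kernel_subset_second_derived
    by (auto simp: kernel_def H N_def simp del: free_group_sel)
  \<comment> \<open>This is the induced map of the first isomorphism theorem; the isomorphism asked
    for runs the other way and is its inverse.\<close>
  define \<psi> where "\<psi> C = the_elem (fev ` C)" for C
  have \<psi>: "\<psi> \<in> iso (F2 Mod N) H"
    using fH.FactGroup_iso_set fev_image unfolding ker \<psi>_def [abs_def] by (simp add: H)
  have coset: "N #>\<^bsub>F2\<^esub> w \<in> carrier (F2 Mod N)" if "w \<in> carrier F2" for w
    using that unfolding carrier_FactGroup by blast
  have \<psi>_coset: "\<psi> (N #>\<^bsub>F2\<^esub> w) = fev w" if "w \<in> carrier F2" for w
  proof -
    have "fev ` (N #>\<^bsub>F2\<^esub> w) = {fev w}"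
    proof
      show "fev ` (N #>\<^bsub>F2\<^esub> w) \<subseteq> {fev w}"
        using that unfolding ker [symmetric] r_coset_def kernel_def
        by (auto simp del: free_group_sel simp: H)
      have "w \<in> N #>\<^bsub>F2\<^esub> w"
        using that second_derived_normal unfolding N_def
        by (intro F2.rcos_self) (auto simp: normal_imp_subgroup simp del: free_group_sel)
      then show "{fev w} \<subseteq> fev ` (N #>\<^bsub>F2\<^esub> w)" by blast
    qed
    then show ?thesis by (simp add: \<psi>_def)
  qed
  define \<phi> where "\<phi> = inv_into (carrier (F2 Mod N)) \<psi>"
  have inj: "inj_on \<psi> (carrier (F2 Mod N))"
    using \<psi> by (simp add: iso_def bij_betw_def)
  have "\<phi> \<in> iso H (F2 Mod N)"
    unfolding \<phi>_def using second_derived_normal \<psi>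
    by (intro group.iso_set_sym normal.factorgroup_is_group) (simp_all add: N_def)
  moreover have "\<phi> (free_rot x) = N #>\<^bsub>F2\<^esub> fgen x" for x
  proof -
    have x: "fgen x \<in> carrier F2" by (simp add: fgen_def)
    show ?thesis
      unfolding \<phi>_def using inv_into_f_f [OF inj coset [OF x]] \<psi>_coset [OF x] by (simp add: fev_fgen)
  qed
  from this [of False] this [of True]
  have "\<phi> rot2 = N #>\<^bsub>F2\<^esub> fgen False" "\<phi> rot3 = N #>\<^bsub>F2\<^esub> fgen True"
    by (simp_all add: free_rot_def)
  ultimately show ?thesis
    unfolding H_def [symmetric] free_metabelian2_def N_def by blast
qed

end

theorem theorem5p1:
  fixes A1 A2 A3 :: complex
  assumes nondeg: "Im ((A2 - A1) * cnj (A3 - A1)) \<noteq> 0"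
    and generic: "generic_triangle A1 A2 A3"
  defines "r1 \<equiv> tri_refl1 A1 A2 A3" and "r2 \<equiv> tri_refl2 A1 A2 A3" and "r3 \<equiv> tri_refl3 A1 A2 A3"
  defines "G \<equiv> triangle_group A1 A2 A3" and "H \<equiv> rotation_subgroup A1 A2 A3"
  shows "carrier H = generate E2_group {r1 \<otimes>\<^bsub>E2_group\<^esub> r2, r1 \<otimes>\<^bsub>E2_group\<^esub> r3}
         \<and> (\<exists>\<phi> \<in> iso H free_metabelian2.
              \<phi> (r1 \<otimes>\<^bsub>E2_group\<^esub> r2) = second_derived F2 #>\<^bsub>F2\<^esub> fgen False
            \<and> \<phi> (r1 \<otimes>\<^bsub>E2_group\<^esub> r3) = second_derived F2 #>\<^bsub>F2\<^esub> fgen True)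
         \<and> \<not> finitely_presented G"
proof -
  interpret generic_triangle_group A1 A2 A3
    by unfold_locales (rule nondeg, rule generic)
  have rot: "r1 \<otimes>\<^bsub>E2_group\<^esub> r2 = rot2" "r1 \<otimes>\<^bsub>E2_group\<^esub> r3 = rot3"
    by (simp_all add: rot2_def rot3_def refl_def r1_def r2_def r3_def)
  have "carrier H = generate E2_group {rot2, rot3}"
    by (simp add: H_def rotation_subgroup_def rotation_subgroup_generated)
  then show ?thesis
    unfolding rot using rotation_subgroup_iso not_finitely_presented by (simp add: H_def G_def)
qed

end
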